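(* Let $(\mathcal{G}_1,e_1,f_1)$ and $(\mathcal{G}_2,e_2,f_2)$ be birooted graphs, let $\mu_i$ be the spectral distribution of $(\mathcal{G}_i,e_i)$ and $\nu_i$ the spectral distribution of $(\mathcal{G}_i,f_i)$, $i=1,2$, and suppose that $\nu_2$ is not concentrated at zero. Let $(\mathcal{G},e,f)=(\mathcal{G}_1,e_1,f_1)\vartriangleright_{\ell}(\mathcal{G}_2,e_2,f_2)$ be their c-comb loop product, naturally colored, and let $a(\mathcal{G})=R_1+R_2$ be the decomposition of its adjacency matrix induced by the coloring of edges. Then, for every $n\in\mathbb{N}$, $$N_{Z,e}(n)=N_{\mu_1\circlearrowright_{\nu_2}\mu_2}(n)=|D_{2n}(e)|,$$ $$N_{Z,f}(n)=N_{\nu_1\circlearrowright\nu_2}(n)=|D_{2n}(f)|,$$ where $Z=R_2R_1$ and $D_{2n}(e)$, $D_{2n}(f)$ denote the sets of alternating d-walks of length $2n$ from $e$ to $e$ and from $f$ to $f$, respectively.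
   Context: Graphs are non-oriented, uniformly locally finite (vertex degrees uniformly bounded), possibly disconnected with finitely many components, and may have loops. A birooted graph $(\mathcal{G},e,f)$ is a graph with two distinguished vertices $e,f$ (roots; allowed to coincide). The adjacency matrix $a(\mathcal{G})$ acts on $\ell^2(V)$ and its $(x,y)$ entry is the number of edges joining $x$ and $y$ (each loop counted once). The spectral distribution of a rooted graph $(\mathcal{G},e)$ is the distribution with moments $\langle a(\mathcal{G})^n\delta(e),\delta(e)\rangle$, where $\delta(e)$ is the basis vector at $e$. Products. The comb product $(\mathcal{G}_1,f_1)\vartriangleright(\mathcal{G}_2,f_2)$ is obtained by attaching (gluing) a copy of $\mathcal{G}_2$ by its vertex $f_2$ to each vertex of $\mathcal{G}_1$; its root $f$ is the vertex obtained by identifying $f_1$ with $f_2$ in the copy attached there. The comb loop product $(\mathcal{G}_1,f_1)\vartriangleright_{\ell}(\mathcal{G}_2,f_2)$ is obtained from it by adding a loop of color $1$ at each vertex but the root $f_2$ of each copy of $\mathcal{G}_2$. The graph $(\mathcal{G}_1,e_1)\vartriangleright_{f_2}(\mathcal{G}_2,e_2)$ is obtained by attaching a copy of $\mathcal{G}_2$ by $e_2$ to the root $e_1$ of $\mathcal{G}_1$ and a copy of $\mathcal{G}_2$ by $f_2$ to each of the remaining vertices of $\mathcal{G}_1$; its root $e$ is the vertex obtained by identifying $e_1$ with $e_2$ in the copy attached there. The graph $(\mathcal{G}_1,e_1)\vartriangleright_{\ell,f_2}(\mathcal{G}_2,e_2)$ is obtained from it by adding a loop of color $1$ at each vertex but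 $e_2$ of the copy of $\mathcal{G}_2$ attached to $e_1$, and at each vertex but $f_2$ of all the remaining copies of $\mathcal{G}_2$. The c-comb loop product is the disjoint union $$(\mathcal{G},e,f)=\big((\mathcal{G}_1,e_1)\vartriangleright_{\ell,f_2}(\mathcal{G}_2,e_2)\big)\oplus\big((\mathcal{G}_1,f_1)\vartriangleright_{\ell}(\mathcal{G}_2,f_2)\big),$$ with $e$ the root of the first summand and $f$ the root of the second. Coloring. Naturally colored means that all edges of copies of $\mathcal{G}_i$ have color $i$, $i=1,2$ (and the added loops have color $1$ as described). $R_i$ is the one-color adjacency matrix counting only the edges of color $i$. Walks. Walks are sequences of consecutive edges (loops allowed). A walk is alternating if consecutive edges have different colors. A d-walk ("double return walk originating with color $1$") from a root $r$ to $r$ is a walk starting at $r$ whose first edge has color $1$ and which returns to $r$ exactly twice, the second return being at its end. Transforms. For a distribution $\mu$ (normalized linear functional on $\mathbb{C}[X]$) let $\psi_\mu(z)=\sum_{n\ge1}\mu(X^n)z^n$ and $\eta_\mu(z)=\dfrac{\psi_\mu(z)}{1+\psi_\mu(z)}=\sum_{n\ge1}N_\mu(n)z^n$ (formal power series). $N_{Z,e}(n)$ and $N_{Z,f}(n)$ are the analogous coefficients of $\eta_Z$ when $\psi_Z(z)=\sum_{n\geq 1}\varphi(Z^n)z^n$ is computed in the vector state $\varphi$ given by $\delta(e)$, respectively $\delta(f)$. The convolutions are defined by $$\eta_{\nu_1\circlearrowright\nu_2}(z)=\eta_{\nu_1}(\eta_{\nu_2}(z)),\qquad \eta_{\mu_1\circlearrowright_{\nu_2}\mu_2}(z)=\frac{\eta_{\mu_2}(z)}{\eta_{\nu_2}(z)}\,\eta_{\mu_1}(\eta_{\nu_2}(z)),$$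 the latter when $\nu_2$ is not concentrated at zero. *)

theory Defs
  imports "HOL-Analysis.Infinite_Sum" "HOL-Analysis.Convex" "HOL-Computational_Algebra.Polynomial"
    "HOL-Computational_Algebra.Formal_Power_Series"
begin

section \<open>Graphs\<close>

text \<open>Non-oriented multigraphs: an edge \<open>a\<close> joins \<open>x\<close> and \<open>y\<close> iff \<open>ends G a = {x, y}\<close>; it is a loop iff
  \<open>x = y\<close>.\<close>

record ('v, 'e) mgraph =
  verts :: "'v set"
  edges :: "'e set"
  ends :: "'e \<Rightarrow> 'v set"

record ('v, 'e) cgraph = "('v, 'e) mgraph" +
  color :: "'e \<Rightarrow> nat"

definition wf_mgraph :: "('v, 'e, 'm) mgraph_scheme \<Rightarrow> bool" where
  "wf_mgraph G \<longleftrightarrow> (\<forall>a\<in>edges G. \<exists>x\<in>verts G. \<exists>y\<in>verts G. ends G a = {x, y})"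

definition incident :: "('v, 'e, 'm) mgraph_scheme \<Rightarrow> 'v \<Rightarrow> 'e set" where
  "incident G x = {a \<in> edges G. x \<in> ends G a}"

definition uniformly_locally_finite :: "('v, 'e, 'm) mgraph_scheme \<Rightarrow> bool" where
  "uniformly_locally_finite G \<longleftrightarrow>
     (\<exists>d. \<forall>x\<in>verts G. finite (incident G x) \<and> card (incident G x) \<le> d)"

definition adjacent :: "('v, 'e, 'm) mgraph_scheme \<Rightarrow> ('v \<times> 'v) set" where
  "adjacent G = {(x, y). \<exists>a\<in>edges G. ends G a = {x, y}}"

definition components :: "('v, 'e, 'm) mgraph_scheme \<Rightarrow> 'v set set" where
  "components G = (\<lambda>x. (adjacent G)\<^sup>* `` {x}) ` verts G"

definition birooted_graph :: "('v, 'e, 'm) mgraph_scheme \<times> 'v \<times> 'v \<Rightarrow> bool" where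
  "birooted_graph = (\<lambda>(G, e, f).
     wf_mgraph G \<and> uniformly_locally_finite G \<and> finite (components G) \<and>
     e \<in> verts G \<and> f \<in> verts G)"

section \<open>Adjacency operators\<close>

definition adj_matrix :: "('v, 'e, 'm) mgraph_scheme \<Rightarrow> 'v \<Rightarrow> 'v \<Rightarrow> complex" where
  "adj_matrix G x y = of_nat (card {a \<in> edges G. ends G a = {x, y}})"

definition color_matrix :: "('v, 'e, 'm) cgraph_scheme \<Rightarrow> nat \<Rightarrow> 'v \<Rightarrow> 'v \<Rightarrow> complex" where
  "color_matrix G i x y = of_nat (card {a \<in> edges G. ends G a = {x, y} \<and> color G a = i})"

text \<open>Elements of $\ell^2(V)$ are functions vanishing outside \<open>V\<close>. The matrix action below makes sense
  for all functions when the rows of \<open>A\<close> are finitely supported; for the matrices of uniformly locally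
  finite graphs it preserves $\ell^2(V)$ (lemma \<open>adj_op_l2\<close>).\<close>

definition l2 :: "'v set \<Rightarrow> ('v \<Rightarrow> complex) set" where
  "l2 V = {u. (\<forall>x. x \<notin> V \<longrightarrow> u x = 0) \<and> (\<lambda>x. (cmod (u x))\<^sup>2) summable_on V}"

definition l2_inner :: "'v set \<Rightarrow> ('v \<Rightarrow> complex) \<Rightarrow> ('v \<Rightarrow> complex) \<Rightarrow> complex" where
  "l2_inner V u w = (\<Sum>\<^sub>\<infinity>x\<in>V. u x * cnj (w x))"

definition delta :: "'v \<Rightarrow> 'v \<Rightarrow> complex" where
  "delta e = (\<lambda>x. if x = e then 1 else 0)"

definition matrix_op :: "'v set \<Rightarrow> ('v \<Rightarrow> 'v \<Rightarrow> complex) \<Rightarrow> ('v \<Rightarrow> complex) \<Rightarrow> 'v \<Rightarrow> complex" where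
  "matrix_op V A u = (\<lambda>x. if x \<in> V then \<Sum>\<^sub>\<infinity>y\<in>V. A x y * u y else 0)"

definition adj_op :: "('v, 'e, 'm) mgraph_scheme \<Rightarrow> ('v \<Rightarrow> complex) \<Rightarrow> 'v \<Rightarrow> complex" where
  "adj_op G = matrix_op (verts G) (adj_matrix G)"

definition color_op :: "('v, 'e, 'm) cgraph_scheme \<Rightarrow> nat \<Rightarrow> ('v \<Rightarrow> complex) \<Rightarrow> 'v \<Rightarrow> complex" where
  "color_op G i = matrix_op (verts G) (color_matrix G i)"

definition vector_state :: "'v set \<Rightarrow> 'v \<Rightarrow> (('v \<Rightarrow> complex) \<Rightarrow> 'v \<Rightarrow> complex) \<Rightarrow> complex" where
  "vector_state V e T = l2_inner V (T (delta e)) (delta e)"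

section \<open>Distributions and transforms\<close>

definition distribution :: "(complex poly \<Rightarrow> complex) \<Rightarrow> bool" where
  "distribution \<mu> \<longleftrightarrow> (\<forall>p q. \<mu> (p + q) = \<mu> p + \<mu> q) \<and> (\<forall>c p. \<mu> (smult c p) = c * \<mu> p) \<and> \<mu> 1 = 1"

definition moment :: "(complex poly \<Rightarrow> complex) \<Rightarrow> nat \<Rightarrow> complex" where
  "moment \<mu> n = \<mu> (monom 1 n)"

definition distr_of_moments :: "(nat \<Rightarrow> complex) \<Rightarrow> complex poly \<Rightarrow> complex" where
  "distr_of_moments m p = (\<Sum>i\<le>degree p. coeff p i * m i)"

definition concentrated_at_zero :: "(complex poly \<Rightarrow> complex) \<Rightarrow> bool" where
  "concentrated_at_zero \<mu> \<longleftrightarrow> (\<forall>p. \<mu> p = poly p 0)"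

definition spectral_distr :: "('v, 'e, 'm) mgraph_scheme \<Rightarrow> 'v \<Rightarrow> complex poly \<Rightarrow> complex" where
  "spectral_distr G e = distr_of_moments (\<lambda>n. vector_state (verts G) e (adj_op G ^^ n))"

definition psi_series :: "(nat \<Rightarrow> complex) \<Rightarrow> complex fps" where
  "psi_series m = Abs_fps (\<lambda>n. if n = 0 then 0 else m n)"

definition eta_series :: "(nat \<Rightarrow> complex) \<Rightarrow> complex fps" where
  "eta_series m = psi_series m / (1 + psi_series m)"

definition eta :: "(complex poly \<Rightarrow> complex) \<Rightarrow> complex fps" where
  "eta \<mu> = eta_series (moment \<mu>)"

definition N_distr :: "(complex poly \<Rightarrow> complex) \<Rightarrow> nat \<Rightarrow> complex" where
  "N_distr \<mu> n = fps_nth (eta \<mu>) n"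

definition N_op :: "'v set \<Rightarrow> (('v \<Rightarrow> complex) \<Rightarrow> 'v \<Rightarrow> complex) \<Rightarrow> 'v \<Rightarrow> nat \<Rightarrow> complex" where
  "N_op V Z e n = fps_nth (eta_series (\<lambda>k. vector_state V e (Z ^^ k))) n"

text \<open>The description is proper whenever \<open>h $ 0 = 0\<close> (lemma \<open>ex1_distribution_eta\<close>).\<close>

definition distr_of_eta :: "complex fps \<Rightarrow> complex poly \<Rightarrow> complex" where
  "distr_of_eta h = (THE \<mu>. distribution \<mu> \<and> eta \<mu> = h)"

definition mono_conv ::
  "(complex poly \<Rightarrow> complex) \<Rightarrow> (complex poly \<Rightarrow> complex) \<Rightarrow> complex poly \<Rightarrow> complex" where
  "mono_conv \<nu>1 \<nu>2 = distr_of_eta (eta \<nu>1 oo eta \<nu>2)"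

text \<open>The quotient $\eta_{\mu_2}/\eta_{\nu_2}$ alone need not be a power series, so the product is formed
  before dividing; the division is exact since \<open>eta \<nu>2\<close> divides \<open>eta \<mu>1 oo eta \<nu>2\<close>
  (lemma \<open>c_conv_series_exact\<close>).\<close>

definition c_conv_series ::
  "(complex poly \<Rightarrow> complex) \<Rightarrow> (complex poly \<Rightarrow> complex) \<Rightarrow> (complex poly \<Rightarrow> complex) \<Rightarrow> complex fps" where
  "c_conv_series \<mu>1 \<nu>2 \<mu>2 = (eta \<mu>2 * (eta \<mu>1 oo eta \<nu>2)) / eta \<nu>2"

definition c_conv ::
  "(complex poly \<Rightarrow> complex) \<Rightarrow> (complex poly \<Rightarrow> complex) \<Rightarrow> (complex poly \<Rightarrow> complex) \<Rightarrow>
   complex poly \<Rightarrow> complex" where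
  "c_conv \<mu>1 \<nu>2 \<mu>2 = distr_of_eta (c_conv_series \<mu>1 \<nu>2 \<mu>2)"

section \<open>Products of graphs\<close>

text \<open>To each vertex \<open>x\<close> of \<open>G1\<close> attach a copy of \<open>G2\<close> by its vertex \<open>r x\<close>. The vertex \<open>(x, y)\<close> is \<open>y\<close> in
  the copy attached to \<open>x\<close>, and \<open>(x, r x)\<close> is \<open>x\<close> itself. Edges of \<open>G1\<close> have color 1, edges of the
  copies of \<open>G2\<close> have color 2.\<close>

definition attach ::
  "('v1, 'e1) mgraph \<Rightarrow> ('v1 \<Rightarrow> 'v2) \<Rightarrow> ('v2, 'e2) mgraph \<Rightarrow>
   ('v1 \<times> 'v2, 'e1 + 'v1 \<times> 'e2) cgraph" where
  "attach G1 r G2 =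
     \<lparr> verts = verts G1 \<times> verts G2,
       edges = edges G1 <+> (verts G1 \<times> edges G2),
       ends = case_sum (\<lambda>a. (\<lambda>x. (x, r x)) ` ends G1 a) (\<lambda>(x, b). Pair x ` ends G2 b),
       color = case_sum (\<lambda>_. 1) (\<lambda>_. 2) \<rparr>"

definition add_loops :: "('v, 'e) cgraph \<Rightarrow> 'v set \<Rightarrow> ('v, 'e + 'v) cgraph" where
  "add_loops G S =
     \<lparr> verts = verts G,
       edges = edges G <+> S,
       ends = case_sum (ends G) (\<lambda>x. {x}),
       color = case_sum (color G) (\<lambda>_. 1) \<rparr>"

definition comb ::
  "('v1, 'e1) mgraph \<times> 'v1 \<Rightarrow> ('v2, 'e2) mgraph \<times> 'v2 \<Rightarrow>
   ('v1 \<times> 'v2, 'e1 + 'v1 \<times> 'e2) cgraph \<times> ('v1 \<times> 'v2)" where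
  "comb = (\<lambda>(G1, f1) (G2, f2). (attach G1 (\<lambda>_. f2) G2, (f1, f2)))"

definition comb_loop ::
  "('v1, 'e1) mgraph \<times> 'v1 \<Rightarrow> ('v2, 'e2) mgraph \<times> 'v2 \<Rightarrow>
   ('v1 \<times> 'v2, ('e1 + 'v1 \<times> 'e2) + 'v1 \<times> 'v2) cgraph \<times> ('v1 \<times> 'v2)" where
  "comb_loop = (\<lambda>(G1, f1) (G2, f2).
     let (G, f) = comb (G1, f1) (G2, f2)
     in (add_loops G {(x, y). x \<in> verts G1 \<and> y \<in> verts G2 \<and> y \<noteq> f2}, f))"

definition comb_at ::
  "'v2 \<Rightarrow> ('v1, 'e1) mgraph \<times> 'v1 \<Rightarrow> ('v2, 'e2) mgraph \<times> 'v2 \<Rightarrow>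
   ('v1 \<times> 'v2, 'e1 + 'v1 \<times> 'e2) cgraph \<times> ('v1 \<times> 'v2)" where
  "comb_at f2 = (\<lambda>(G1, e1) (G2, e2).
     (attach G1 (\<lambda>x. if x = e1 then e2 else f2) G2, (e1, e2)))"

definition comb_loop_at ::
  "'v2 \<Rightarrow> ('v1, 'e1) mgraph \<times> 'v1 \<Rightarrow> ('v2, 'e2) mgraph \<times> 'v2 \<Rightarrow>
   ('v1 \<times> 'v2, ('e1 + 'v1 \<times> 'e2) + 'v1 \<times> 'v2) cgraph \<times> ('v1 \<times> 'v2)" where
  "comb_loop_at f2 = (\<lambda>(G1, e1) (G2, e2).
     let (G, e) = comb_at f2 (G1, e1) (G2, e2)
     in (add_loops G {(x, y). x \<in> verts G1 \<and> y \<in> verts G2 \<and> y \<noteq> (if x = e1 then e2 else f2)}, e))"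

definition disjoint_union ::
  "('v, 'e) cgraph \<Rightarrow> ('w, 'd) cgraph \<Rightarrow> ('v + 'w, 'e + 'd) cgraph" where
  "disjoint_union G H =
     \<lparr> verts = verts G <+> verts H,
       edges = edges G <+> edges H,
       ends = case_sum (\<lambda>a. Inl ` ends G a) (\<lambda>b. Inr ` ends H b),
       color = case_sum (color G) (color H) \<rparr>"

type_synonym ('v1, 'e1, 'v2, 'e2) c_comb_loop_graph =
  "('v1 \<times> 'v2 + 'v1 \<times> 'v2,
    (('e1 + 'v1 \<times> 'e2) + 'v1 \<times> 'v2) + (('e1 + 'v1 \<times> 'e2) + 'v1 \<times> 'v2)) cgraph"

definition c_comb_loop ::
  "('v1, 'e1) mgraph \<times> 'v1 \<times> 'v1 \<Rightarrow> ('v2, 'e2) mgraph \<times> 'v2 \<times> 'v2 \<Rightarrow>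
   ('v1, 'e1, 'v2, 'e2) c_comb_loop_graph \<times> ('v1 \<times> 'v2 + 'v1 \<times> 'v2) \<times> ('v1 \<times> 'v2 + 'v1 \<times> 'v2)" where
  "c_comb_loop = (\<lambda>(G1, e1, f1) (G2, e2, f2).
     let (G, e) = comb_loop_at f2 (G1, e1) (G2, e2);
         (H, f) = comb_loop (G1, f1) (G2, f2)
     in (disjoint_union G H, Inl e, Inr f))"

section \<open>Walks\<close>

text \<open>A walk is given by its vertices \<open>xs\<close> and its edges \<open>as\<close>, one fewer. Once the starting vertex is
  fixed, the edges determine the vertices, so counting such pairs counts edge sequences.\<close>

definition walk :: "('v, 'e, 'm) mgraph_scheme \<Rightarrow> 'v list \<times> 'e list \<Rightarrow> bool" where
  "walk G = (\<lambda>(xs, as). length xs = Suc (length as) \<and> set xs \<subseteq> verts G \<and>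
     (\<forall>i<length as. as ! i \<in> edges G \<and> ends G (as ! i) = {xs ! i, xs ! Suc i}))"

definition alternating :: "('v, 'e, 'm) cgraph_scheme \<Rightarrow> 'v list \<times> 'e list \<Rightarrow> bool" where
  "alternating G = (\<lambda>(xs, as).
     \<forall>i. Suc i < length as \<longrightarrow> color G (as ! i) \<noteq> color G (as ! Suc i))"

definition returns :: "'v \<Rightarrow> 'v list \<times> 'e list \<Rightarrow> nat set" where
  "returns r = (\<lambda>(xs, as). {i. 0 < i \<and> i \<le> length as \<and> xs ! i = r})"

definition d_walk :: "('v, 'e, 'm) cgraph_scheme \<Rightarrow> 'v \<Rightarrow> 'v list \<times> 'e list \<Rightarrow> bool" where
  "d_walk G r = (\<lambda>(xs, as). walk G (xs, as) \<and> as \<noteq> [] \<and> hd xs = r \<and> last xs = r \<and>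
     color G (hd as) = 1 \<and> card (returns r (xs, as)) = 2)"

definition alt_d_walks :: "('v, 'e, 'm) cgraph_scheme \<Rightarrow> nat \<Rightarrow> 'v \<Rightarrow> ('v list \<times> 'e list) set" where
  "alt_d_walks G m r = {(xs, as). d_walk G r (xs, as) \<and> alternating G (xs, as) \<and> length as = m}"

section \<open>Well-definedness\<close>

lemma distribution_of_moments:
  assumes "m 0 = 1"
  shows "distribution (distr_of_moments m)" "moment (distr_of_moments m) n = m n"
proof -
  have bd: "distr_of_moments m p = (\<Sum>i\<le>d. coeff p i * m i)" if "degree p \<le> d" for p d
    unfolding distr_of_moments_def using that
    by (intro sum.mono_neutral_left) (auto simp: coeff_eq_0)
  have "distr_of_moments m (p + q) = distr_of_moments m p + distr_of_moments m q" for p q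
  proof -
    let ?d = "max (degree p) (degree q)"
    show ?thesis
      using bd[of p ?d] bd[of q ?d] bd[of "p + q" ?d] degree_add_le_max[of p q]
      by (simp add: sum.distrib algebra_simps)
  qed
  moreover have "distr_of_moments m (smult c p) = c * distr_of_moments m p" for c p
    using bd[of "smult c p" "degree p"] bd[of p "degree p"] degree_smult_le[of c p]
    by (simp add: sum_distrib_left algebra_simps)
  moreover have "distr_of_moments m 1 = 1" using assms by (simp add: distr_of_moments_def)
  ultimately show "distribution (distr_of_moments m)" by (simp add: distribution_def)
  show "moment (distr_of_moments m) n = m n"
    unfolding moment_def using bd[of "monom 1 n" n] by (simp add: degree_monom_eq if_distrib[of "\<lambda>x. x * _"] cong: if_cong)
qed

lemma distribution_spectral_distr:
  assumes "e \<in> verts G"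
  shows "distribution (spectral_distr G e)"
    and "moment (spectral_distr G e) n = vector_state (verts G) e (adj_op G ^^ n)"
proof -
  let ?m = "\<lambda>n. vector_state (verts G) e (adj_op G ^^ n)"
  have "?m 0 = (\<Sum>\<^sub>\<infinity>x\<in>verts G. delta e x * cnj (delta e x))"
    by (simp add: vector_state_def l2_inner_def)
  also have "\<dots> = (\<Sum>\<^sub>\<infinity>x\<in>{e}. 1)"
    using assms by (intro infsum_cong_neutral) (auto simp: delta_def split: if_splits)
  finally have 1: "?m 0 = 1" by simp
  show "distribution (spectral_distr G e)" "moment (spectral_distr G e) n = ?m n"
    unfolding spectral_distr_def
    using distribution_of_moments[where m = ?m, OF 1] by blast+
qed

lemma distribution_eqI:
  assumes "distribution \<mu>" "distribution \<nu>" "\<And>n. n > 0 \<Longrightarrow> moment \<mu> n = moment \<nu> n"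
  shows "\<mu> = \<nu>"
proof
  fix p
  have m: "\<mu> (monom 1 n) = \<nu> (monom 1 n)" for n
    using assms by (cases "n = 0") (auto simp: moment_def distribution_def)
  have z: "\<mu> 0 = 0" "\<nu> 0 = 0"
    using assms(1,2) unfolding distribution_def by (metis mult_zero_left smult_0_left)+
  have "\<mu> (\<Sum>i\<in>I. smult (c i) (monom 1 i)) = \<nu> (\<Sum>i\<in>I. smult (c i) (monom 1 i))" if "finite I" for I c
    using that by induction (use z assms m in \<open>auto simp: distribution_def simp del: smult_monom\<close>)
  from this[of "{..degree p}" "coeff p"] show "\<mu> p = \<nu> p"
    by (simp add: smult_monom poly_as_sum_of_monoms)
qed

lemma eta_nth_0: "fps_nth (eta \<mu>) 0 = 0"
  by (simp add: eta_def eta_series_def psi_series_def fps_divide_unit)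

lemma eta_series_eq_iff:
  assumes "fps_nth h 0 = 0"
  shows "eta_series m = h \<longleftrightarrow> psi_series m = h / (1 - h)"
proof -
  have d: "x / y = z \<longleftrightarrow> x = z * y" if "fps_nth y 0 \<noteq> 0" for x y z :: "complex fps"
  proof -
    have "inverse y * y = 1" using that by (rule inverse_mult_eq_1)
    then have "x * inverse y * y = x" "z * y * inverse y = z"
      by (metis mult.assoc mult.commute mult.right_neutral)+
    then show ?thesis unfolding fps_divide_unit[OF that] by metis
  qed
  have a: "fps_nth (1 + psi_series m) 0 \<noteq> 0" "fps_nth (1 - h) 0 \<noteq> 0"
    using assms by (simp_all add: psi_series_def)
  have "eta_series m = h \<longleftrightarrow> psi_series m = h * (1 + psi_series m)"
    unfolding eta_series_def by (rule d[OF a(1)])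
  also have "\<dots> \<longleftrightarrow> h = psi_series m * (1 - h)"
    by (auto simp: algebra_simps)
  also have "\<dots> \<longleftrightarrow> psi_series m = h / (1 - h)"
    using d[OF a(2), of h "psi_series m"] by metis
  finally show ?thesis .
qed

lemma ex1_distribution_eta:
  assumes "fps_nth h 0 = 0"
  shows "\<exists>!\<mu>. distribution \<mu> \<and> eta \<mu> = h"
proof (rule ex_ex1I)
  define m where "m n = (if n = 0 then 1 else fps_nth (h / (1 - h)) n)" for n
  have "fps_nth (h / (1 - h)) 0 = 0"
    using assms by (simp add: fps_divide_unit)
  then have "psi_series (moment (distr_of_moments m)) = h / (1 - h)"
    by (intro fps_ext) (simp add: psi_series_def distribution_of_moments(2) m_def)
  then show "\<exists>\<mu>. distribution \<mu> \<and> eta \<mu> = h"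
    using distribution_of_moments(1)[of m] eta_series_eq_iff[OF assms]
    by (auto simp: eta_def m_def)
next
  fix \<mu> \<nu> assume *: "distribution \<mu> \<and> eta \<mu> = h" "distribution \<nu> \<and> eta \<nu> = h"
  then have "psi_series (moment \<mu>) = psi_series (moment \<nu>)"
    using eta_series_eq_iff[OF assms] by (simp add: eta_def)
  then have "fps_nth (psi_series (moment \<mu>)) n = fps_nth (psi_series (moment \<nu>)) n" for n
    by simp
  then have "moment \<mu> n = moment \<nu> n" if "n > 0" for n
    using that by (simp add: psi_series_def split: if_splits) (metis gr_implies_not0)
  with * show "\<mu> = \<nu>" by (blast intro: distribution_eqI)
qed

lemma c_conv_series_exact:
  assumes "eta \<nu>2 \<noteq> 0"
  shows "c_conv_series \<mu>1 \<nu>2 \<mu>2 * eta \<nu>2 = eta \<mu>2 * (eta \<mu>1 oo eta \<nu>2)"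
    and "fps_nth (c_conv_series \<mu>1 \<nu>2 \<mu>2) 0 = 0"
proof -
  define g where "g = fps_shift 1 (eta \<mu>1) oo eta \<nu>2"
  have "eta \<mu>1 = fps_shift 1 (eta \<mu>1) * fps_X"
    by (rule fps_ext) (simp add: eta_nth_0)
  then have "eta \<mu>1 oo eta \<nu>2 = g * eta \<nu>2"
    unfolding g_def by (metis eta_nth_0 fps_X_fps_compose_startby0 fps_compose_mult_distrib)
  then have *: "eta \<mu>2 * (eta \<mu>1 oo eta \<nu>2) = (eta \<mu>2 * g) * eta \<nu>2" by simp
  then have "c_conv_series \<mu>1 \<nu>2 \<mu>2 = eta \<mu>2 * g"
    unfolding c_conv_series_def by (simp only: * nonzero_mult_div_cancel_right[OF assms])
  with * show "c_conv_series \<mu>1 \<nu>2 \<mu>2 * eta \<nu>2 = eta \<mu>2 * (eta \<mu>1 oo eta \<nu>2)"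
    "fps_nth (c_conv_series \<mu>1 \<nu>2 \<mu>2) 0 = 0"
    by (simp_all only: fps_mult_nth_0 eta_nth_0 mult_zero_left)
qed

lemma eta_eq_0_iff:
  assumes "distribution \<mu>"
  shows "eta \<mu> = 0 \<longleftrightarrow> concentrated_at_zero \<mu>"
proof -
  have d: "distribution (\<lambda>p. poly p 0 :: complex)" by (simp add: distribution_def)
  have "eta (\<lambda>p. poly p 0) = 0"
    unfolding eta_def
    by (subst eta_series_eq_iff) (auto simp: psi_series_def moment_def poly_monom fps_eq_iff)
  moreover have "concentrated_at_zero \<mu> \<longleftrightarrow> \<mu> = (\<lambda>p. poly p 0)"
    by (auto simp: concentrated_at_zero_def)
  ultimately show ?thesis
    using ex1_distribution_eta[of 0] assms d by (metis fps_zero_nth)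
qed

lemma color_matrix_sum:
  fixes G :: "('v, 'e, 'm) cgraph_scheme"
  assumes "wf_mgraph G" "uniformly_locally_finite G" "\<forall>a\<in>edges G. color G a \<in> {1, 2}"
  shows "adj_matrix G x y = color_matrix G 1 x y + color_matrix G 2 x y"
proof -
  let ?E = "\<lambda>i. {a \<in> edges G. ends G a = {x, y} \<and> color G a = i}"
  have fin: "finite {a \<in> edges G. ends G a = {x, y}}"
  proof (cases "x \<in> verts G")
    case True
    have "{a \<in> edges G. ends G a = {x, y}} \<subseteq> incident G x" by (auto simp: incident_def)
    moreover have "finite (incident G x)"
      using True assms(2) by (auto simp: uniformly_locally_finite_def)
    ultimately show ?thesis by (rule finite_subset)
  next
    case False
    have "ends G a \<noteq> {x, y}" if "a \<in> edges G" for a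
      using assms(1) False that unfolding wf_mgraph_def by (metis insertCI insertE singletonD)
    then have "{a \<in> edges G. ends G a = {x, y}} = {}" by blast
    then show ?thesis by (simp only: finite.emptyI)
  qed
  have "{a \<in> edges G. ends G a = {x, y}} = ?E 1 \<union> ?E 2" using assms(3) by auto
  moreover have "finite (?E 1)" "finite (?E 2)" using fin by (auto elim: rev_finite_subset)
  ultimately show ?thesis
    by (simp add: adj_matrix_def color_matrix_def card_Un_disjoint disjoint_iff)
qed

lemma uniformly_locally_finiteI:
  assumes "\<And>x. x \<in> verts G \<Longrightarrow> \<exists>I. incident G x \<subseteq> I \<and> finite I \<and> card I \<le> d"
  shows "uniformly_locally_finite G"
  unfolding uniformly_locally_finite_def
proof (intro exI[of _ d] ballI)
  fix x assume "x \<in> verts G"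
  then obtain I where "incident G x \<subseteq> I" "finite I" "card I \<le> d" using assms by blast
  then show "finite (incident G x) \<and> card (incident G x) \<le> d"
    by (auto intro: finite_subset order_trans[OF card_mono])
qed

lemma attach_graph:
  assumes "wf_mgraph G1" "uniformly_locally_finite G1" "wf_mgraph G2" "uniformly_locally_finite G2"
    "\<And>x. x \<in> verts G1 \<Longrightarrow> r x \<in> verts G2"
  shows "wf_mgraph (attach G1 r G2)" "uniformly_locally_finite (attach G1 r G2)"
proof -
  show "wf_mgraph (attach G1 r G2)"
    unfolding wf_mgraph_def
  proof
    fix c assume "c \<in> edges (attach G1 r G2)"
    then consider a where "c = Inl a" "a \<in> edges G1"
      | x b where "c = Inr (x, b)" "x \<in> verts G1" "b \<in> edges G2"
      by (auto simp: attach_def)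
    then show "\<exists>p\<in>verts (attach G1 r G2). \<exists>q\<in>verts (attach G1 r G2). ends (attach G1 r G2) c = {p, q}"
    proof cases
      case 1
      then obtain x y where "x \<in> verts G1" "y \<in> verts G1" "ends G1 a = {x, y}"
        using assms(1) by (auto simp: wf_mgraph_def)
      then show ?thesis using 1 assms(5)
        by (intro bexI[of _ "(x, r x)"] bexI[of _ "(y, r y)"]) (auto simp: attach_def)
    next
      case 2
      then obtain y z where "y \<in> verts G2" "z \<in> verts G2" "ends G2 b = {y, z}"
        using assms(3) by (auto simp: wf_mgraph_def)
      then show ?thesis using 2
        by (intro bexI[of _ "(x, y)"] bexI[of _ "(x, z)"]) (auto simp: attach_def)
    qed
  qed
  obtain d1 d2 where
    d1: "\<And>x. x \<in> verts G1 \<Longrightarrow> finite (incident G1 x) \<and> card (incident G1 x) \<le> d1" and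
    d2: "\<And>x. x \<in> verts G2 \<Longrightarrow> finite (incident G2 x) \<and> card (incident G2 x) \<le> d2"
    using assms(2,4) by (auto simp: uniformly_locally_finite_def)
  show "uniformly_locally_finite (attach G1 r G2)"
  proof (rule uniformly_locally_finiteI[where d = "d1 + d2"])
    fix p assume "p \<in> verts (attach G1 r G2)"
    then obtain x y where p: "p = (x, y)" "x \<in> verts G1" "y \<in> verts G2" by (auto simp: attach_def)
    let ?I = "Inl ` incident G1 x \<union> (\<lambda>b. Inr (x, b)) ` incident G2 y"
    have "incident (attach G1 r G2) p \<subseteq> ?I"
      by (auto simp: p incident_def attach_def)
    moreover have "card ?I \<le> d1 + d2"
      using d1[OF p(2)] d2[OF p(3)]
      by (intro order_trans[OF card_Un_le add_mono] order_trans[OF card_image_le]) auto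
    ultimately show "\<exists>I. incident (attach G1 r G2) p \<subseteq> I \<and> finite I \<and> card I \<le> d1 + d2"
      using d1[OF p(2)] d2[OF p(3)] by blast
  qed
qed

lemma add_loops_graph:
  assumes "wf_mgraph G" "uniformly_locally_finite G" "S \<subseteq> verts G"
  shows "wf_mgraph (add_loops G S)" "uniformly_locally_finite (add_loops G S)"
proof -
  show "wf_mgraph (add_loops G S)"
    using assms by (fastforce simp: wf_mgraph_def add_loops_def)
  obtain d where d: "\<And>x. x \<in> verts G \<Longrightarrow> finite (incident G x) \<and> card (incident G x) \<le> d"
    using assms(2) by (auto simp: uniformly_locally_finite_def)
  show "uniformly_locally_finite (add_loops G S)"
  proof (rule uniformly_locally_finiteI[where d = "Suc d"])
    fix x assume "x \<in> verts (add_loops G S)"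
    then have x: "x \<in> verts G" by (simp add: add_loops_def)
    let ?I = "insert (Inr x) (Inl ` incident G x)"
    have "incident (add_loops G S) x \<subseteq> ?I" by (auto simp: incident_def add_loops_def)
    moreover have "card ?I \<le> Suc d"
      using d[OF x] by (auto simp: card_insert_if card_image)
    ultimately show "\<exists>I. incident (add_loops G S) x \<subseteq> I \<and> finite I \<and> card I \<le> Suc d"
      using d[OF x] by blast
  qed
qed

lemma disjoint_union_graph:
  assumes "wf_mgraph G" "uniformly_locally_finite G" "wf_mgraph H" "uniformly_locally_finite H"
  shows "wf_mgraph (disjoint_union G H)" "uniformly_locally_finite (disjoint_union G H)"
proof -
  show "wf_mgraph (disjoint_union G H)"
    unfolding wf_mgraph_def
  proof
    fix c assume "c \<in> edges (disjoint_union G H)"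
    then consider a where "c = Inl a" "a \<in> edges G" | a where "c = Inr a" "a \<in> edges H"
      by (auto simp: disjoint_union_def)
    then show "\<exists>p\<in>verts (disjoint_union G H). \<exists>q\<in>verts (disjoint_union G H).
      ends (disjoint_union G H) c = {p, q}"
    proof cases
      case 1
      then obtain x y where "x \<in> verts G" "y \<in> verts G" "ends G a = {x, y}"
        using assms(1) by (auto simp: wf_mgraph_def)
      then show ?thesis using 1
        by (intro bexI[of _ "Inl x"] bexI[of _ "Inl y"]) (auto simp: disjoint_union_def)
    next
      case 2
      then obtain x y where "x \<in> verts H" "y \<in> verts H" "ends H a = {x, y}"
        using assms(3) by (auto simp: wf_mgraph_def)
      then show ?thesis using 2
        by (intro bexI[of _ "Inr x"] bexI[of _ "Inr y"]) (auto simp: disjoint_union_def)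
    qed
  qed
  obtain d1 d2 where
    d1: "\<And>x. x \<in> verts G \<Longrightarrow> finite (incident G x) \<and> card (incident G x) \<le> d1" and
    d2: "\<And>x. x \<in> verts H \<Longrightarrow> finite (incident H x) \<and> card (incident H x) \<le> d2"
    using assms(2,4) by (auto simp: uniformly_locally_finite_def)
  show "uniformly_locally_finite (disjoint_union G H)"
  proof (rule uniformly_locally_finiteI[where d = "d1 + d2"])
    fix p assume "p \<in> verts (disjoint_union G H)"
    then consider x where "p = Inl x" "x \<in> verts G" | x where "p = Inr x" "x \<in> verts H"
      by (auto simp: disjoint_union_def)
    then show "\<exists>I. incident (disjoint_union G H) p \<subseteq> I \<and> finite I \<and> card I \<le> d1 + d2"
    proof cases
      case 1
      then show ?thesis using d1[of x]
        by (intro exI[of _ "Inl ` incident G x"])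
          (auto simp: incident_def disjoint_union_def card_image inj_on_def)
    next
      case 2
      then show ?thesis using d2[of x]
        by (intro exI[of _ "Inr ` incident H x"])
          (auto simp: incident_def disjoint_union_def card_image inj_on_def)
    qed
  qed
qed

lemma c_comb_loop_decomposition:
  assumes "birooted_graph (G1, e1, f1)" "birooted_graph (G2, e2, f2)"
    and "(G, e, f) = c_comb_loop (G1, e1, f1) (G2, e2, f2)"
  shows "wf_mgraph G" "uniformly_locally_finite G" "e \<in> verts G" "f \<in> verts G"
    "adj_matrix G x y = color_matrix G 1 x y + color_matrix G 2 x y"
proof -
  note defs = c_comb_loop_def comb_loop_def comb_loop_at_def comb_def comb_at_def
  have G1: "wf_mgraph G1" "uniformly_locally_finite G1" "e1 \<in> verts G1" "f1 \<in> verts G1"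
   and G2: "wf_mgraph G2" "uniformly_locally_finite G2" "e2 \<in> verts G2" "f2 \<in> verts G2"
    using assms(1,2) by (auto simp: birooted_graph_def)
  define r where "r = (\<lambda>x. if x = e1 then e2 else f2)"
  define S where "S = {(x, y). x \<in> verts G1 \<and> y \<in> verts G2 \<and> y \<noteq> r x}"
  define T where "T = {(x, y). x \<in> verts G1 \<and> y \<in> verts G2 \<and> y \<noteq> f2}"
  have G: "G = disjoint_union (add_loops (attach G1 r G2) S) (add_loops (attach G1 (\<lambda>_. f2) G2) T)"
    and ef: "e = Inl (e1, e2)" "f = Inr (f1, f2)"
    using assms(3) by (simp_all add: defs r_def S_def T_def)
  have "r x \<in> verts G2" for x using G2 by (simp add: r_def)
  moreover have "S \<subseteq> verts (attach G1 r G2)" "T \<subseteq> verts (attach G1 (\<lambda>_. f2) G2)"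
    by (auto simp: S_def T_def attach_def)
  ultimately show wf: "wf_mgraph G" "uniformly_locally_finite G"
    unfolding G using G1 G2 by (auto intro!: disjoint_union_graph add_loops_graph attach_graph)
  show "e \<in> verts G" "f \<in> verts G"
    unfolding G ef using G1 G2 by (auto simp: disjoint_union_def add_loops_def attach_def)
  have "\<forall>a\<in>edges G. color G a \<in> {1, 2}"
    unfolding G by (auto simp: disjoint_union_def add_loops_def attach_def)
  with wf show "adj_matrix G x y = color_matrix G 1 x y + color_matrix G 2 x y"
    by (intro color_matrix_sum)
qed

lemma adj_op_l2:
  assumes "wf_mgraph G" "uniformly_locally_finite G" "u \<in> l2 (verts G)"
  shows "adj_op G u \<in> l2 (verts G)"
proof -
  let ?V = "verts G"
  obtain d where d: "\<And>x. x \<in> ?V \<Longrightarrow> finite (incident G x) \<and> card (incident G x) \<le> d"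
    using assms(2) by (auto simp: uniformly_locally_finite_def)
  define N where "N x = (\<Union>a\<in>incident G x. ends G a)" for x
  have ends: "finite (ends G a) \<and> card (ends G a) \<le> 2 \<and> ends G a \<subseteq> ?V" if "a \<in> edges G" for a
    using assms(1) that unfolding wf_mgraph_def by (fastforce simp: card_insert_if)
  have N: "finite (N x)" "card (N x) \<le> 2 * d" "N x \<subseteq> ?V" if "x \<in> ?V" for x
  proof -
    show "finite (N x)" "N x \<subseteq> ?V"
      using ends d[OF that] by (auto simp: N_def incident_def)
    have "card (N x) \<le> (\<Sum>a\<in>incident G x. card (ends G a))"
      unfolding N_def using d[OF that] by (intro card_UN_le) auto
    also have "\<dots> \<le> card (incident G x) * 2"
      using ends by (intro sum_bounded_above[where K = "2::nat", simplified]) (auto simp: incident_def)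
    finally show "card (N x) \<le> 2 * d" using d[OF that] by linarith
  qed
  have sym: "y \<in> N x \<longleftrightarrow> x \<in> N y" for x y by (auto simp: N_def incident_def)
  have a0: "adj_matrix G x y = 0" if "y \<notin> N x" for x y
  proof -
    have "{a \<in> edges G. ends G a = {x, y}} = {}" using that by (auto simp: N_def incident_def)
    then show ?thesis unfolding adj_matrix_def by (simp only: card.empty of_nat_0)
  qed
  have ad: "cmod (adj_matrix G x y) \<le> d" if "x \<in> ?V" for x y
  proof -
    have "card {a \<in> edges G. ends G a = {x, y}} \<le> card (incident G x)"
      using d[OF that] by (intro card_mono) (auto simp: incident_def)
    then show ?thesis using d[OF that] by (simp add: adj_matrix_def)
  qed
  have bound: "(cmod (adj_op G u x))\<^sup>2 \<le> (real d)\<^sup>2 * (2 * d) * (\<Sum>y\<in>N x. (cmod (u y))\<^sup>2)"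
    if x: "x \<in> ?V" for x
  proof -
    have "adj_op G u x = (\<Sum>\<^sub>\<infinity>y\<in>?V. adj_matrix G x y * u y)"
      using x by (simp add: adj_op_def matrix_op_def)
    also have "\<dots> = (\<Sum>\<^sub>\<infinity>y\<in>N x. adj_matrix G x y * u y)"
      using N(3)[OF x] a0 by (intro infsum_cong_neutral) auto
    also have "\<dots> = (\<Sum>y\<in>N x. adj_matrix G x y * u y)" using N(1)[OF x] by simp
    finally have "cmod (adj_op G u x) \<le> (\<Sum>y\<in>N x. d * cmod (u y))"
      by (auto intro!: sum_norm_le simp: norm_mult ad[OF x] mult_right_mono)
    then have "(cmod (adj_op G u x))\<^sup>2 \<le> (d * (\<Sum>y\<in>N x. cmod (u y)))\<^sup>2"
      by (intro power_mono) (simp_all add: sum_distrib_left)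
    also have "\<dots> = (real d)\<^sup>2 * (\<Sum>y\<in>N x. cmod (u y))\<^sup>2" by (simp add: power_mult_distrib)
    also have "\<dots> \<le> (real d)\<^sup>2 * (card (N x) * (\<Sum>y\<in>N x. (cmod (u y))\<^sup>2))"
      using sum_squared_le_sum_of_squares[of "\<lambda>y. cmod (u y)" "N x"]
      by (intro mult_left_mono) (simp_all add: mult.commute)
    also have "\<dots> \<le> (real d)\<^sup>2 * (real (2 * d) * (\<Sum>y\<in>N x. (cmod (u y))\<^sup>2))"
      using N(2)[OF x] by (intro mult_left_mono mult_right_mono sum_nonneg) (auto simp only: of_nat_le_iff zero_le_power2)
    finally show ?thesis by (simp add: mult_ac)
  qed
  have su: "(\<lambda>x. (cmod (u x))\<^sup>2) summable_on ?V" using assms(3) by (simp add: l2_def)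
  have "(\<lambda>x. (cmod (adj_op G u x))\<^sup>2) summable_on ?V"
  proof (rule nonneg_bdd_above_summable_on)
    show "bdd_above (sum (\<lambda>x. (cmod (adj_op G u x))\<^sup>2) ` {F. F \<subseteq> ?V \<and> finite F})"
    proof (rule bdd_aboveI2)
      fix F assume "F \<in> {F. F \<subseteq> ?V \<and> finite F}"
      then have F: "F \<subseteq> ?V" "finite F" by auto
      define M where "M = \<Union> (N ` F)"
      have M: "finite M" "M \<subseteq> ?V"
        unfolding M_def using F N(1,3) by (blast intro: finite_UN_I, blast)
      have "(\<Sum>x\<in>F. (cmod (adj_op G u x))\<^sup>2)
          \<le> (\<Sum>x\<in>F. (real d)\<^sup>2 * (2 * d) * (\<Sum>y\<in>N x. (cmod (u y))\<^sup>2))"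
        using F bound by (intro sum_mono) auto
      also have "\<dots> = (real d)\<^sup>2 * (2 * d) * (\<Sum>x\<in>F. \<Sum>y | y \<in> M \<and> y \<in> N x. (cmod (u y))\<^sup>2)"
        unfolding sum_distrib_left[symmetric]
        by (intro arg_cong2[where f = "(*)"] sum.cong refl) (auto simp: M_def)
      also have "\<dots> = (real d)\<^sup>2 * (2 * d) * (\<Sum>y\<in>M. \<Sum>x | x \<in> F \<and> y \<in> N x. (cmod (u y))\<^sup>2)"
        using F M by (subst sum.swap_restrict) auto
      also have "\<dots> \<le> (real d)\<^sup>2 * (2 * d) * (\<Sum>y\<in>M. real (2 * d) * (cmod (u y))\<^sup>2)"
      proof (intro mult_left_mono sum_mono)
        fix y assume "y \<in> M"
        then have y: "y \<in> ?V" using M by auto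
        have "card {x \<in> F. y \<in> N x} \<le> card (N y)"
          using N(1)[OF y] sym by (intro card_mono) auto
        then have "real (card {x \<in> F. y \<in> N x}) \<le> real (2 * d)" using N(2)[OF y] by linarith
        then show "(\<Sum>x | x \<in> F \<and> y \<in> N x. (cmod (u y))\<^sup>2) \<le> real (2 * d) * (cmod (u y))\<^sup>2"
          unfolding sum_constant by (rule mult_right_mono) simp
      qed simp
      also have "\<dots> = (real d)\<^sup>2 * (2 * d) * (2 * d) * (\<Sum>y\<in>M. (cmod (u y))\<^sup>2)"
        by (simp add: sum_distrib_left mult_ac)
      also have "\<dots> \<le> (real d)\<^sup>2 * (2 * d) * (2 * d) * (\<Sum>\<^sub>\<infinity>y\<in>?V. (cmod (u y))\<^sup>2)"
        using su M by (intro mult_left_mono finite_sum_le_infsum) auto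
      finally show "(\<Sum>x\<in>F. (cmod (adj_op G u x))\<^sup>2)
          \<le> (real d)\<^sup>2 * (2 * d) * (2 * d) * (\<Sum>\<^sub>\<infinity>y\<in>?V. (cmod (u y))\<^sup>2)" .
    qed
  qed simp
  then show ?thesis by (simp add: l2_def adj_op_def matrix_op_def)
qed

end

theory Submission
  imports Defs
begin

text \<open>Let the walker live on \<open>attach G1 r G2\<close> with its loops, and call the vertices \<open>(x, r x)\<close>, which form a copy
of \<open>G1\<close>, the spine. Off the spine the only edge of color 1 is a loop, and on the spine the edges of
color 1 are those of \<open>G1\<close>. Hence an alternating walk that leaves the spine performs a walk in a single
copy of \<open>G2\<close>, interspersed with loops, until it first comes back to \<open>r x\<close>; it then has to take an
edge of \<open>G1\<close>. So an alternating walk is a walk in \<open>G1\<close> into which a first-return excursion in \<open>G2\<close> is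
inserted at each step. Excursions from a root of \<open>G2\<close> are counted by the \<open>\<eta>\<close>-series of that root:
\<open>\<eta>\<close> turns moments, which count all returns, into the numbers of first returns
(lemma \<open>eta_spectral_distr\<close>).

A d-walk leaves the root \<open>(x0, s)\<close> by color 1, returns to \<open>x0\<close> within \<open>G1\<close> for the first time, and then
makes one excursion in the copy of \<open>G2\<close> attached to the root. If it takes \<open>k\<close> steps in \<open>G1\<close>, then
\<open>k - 1\<close> of its excursions take place at vertices other than \<open>x0\<close>, and the last one at \<open>x0\<close>; an excursion
with \<open>m\<close> edges of \<open>G2\<close> uses \<open>m - 1\<close> loops, so that the whole walk has twice as many edges as it has
edges of color 2. Marking each edge of color 2 by \<open>z\<close> gives
\[ \sum_k N_{x_0}(k) \, \eta_t(z)^{k-1} \, \eta_s(z) = \frac{\eta_s(z)}{\eta_t(z)} \, \eta_{x_0}(\eta_t(z)), \]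
where \<open>t\<close> is the vertex by which the copies away from \<open>x0\<close> are attached. For \<open>s = e2\<close>, \<open>t = f2\<close> this is
the series of the c-convolution, and for \<open>s = t = f2\<close> it is \<open>\<eta>\<close> of \<open>\<nu>1\<close> composed with \<open>\<eta>\<close> of \<open>\<nu>2\<close>.

The same series is the \<open>\<eta>\<close>-series of \<open>R2 R1\<close>: expanding \<open>(R2 R1)^n\<close> in rows, the walks start with color 2
and hence with the excursion at the root, and their returns to the root after an even number of steps
correspond to the factors of a moment.

The decomposition is not carried out on lists of edges. All the numbers involved satisfy one-step
recursions, which are linear equations between power series indexed by the vertices, and a solution
of such a system is determined coefficient by coefficient. It therefore suffices to guess the
solution from the decomposition and to verify the equations: lemma \<open>eta_Z\<close> does this for the operator,
lemma \<open>card_alt_d_walks\<close> for the walks, with the same result.\<close>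

section \<open>Rows of locally finite matrices\<close>

definition neighbours :: "('v, 'e, 'm) mgraph_scheme \<Rightarrow> 'v \<Rightarrow> 'v set" where
  "neighbours G x = (\<Union>a\<in>incident G x. ends G a)"

lemma finite_neighbours:
  assumes "wf_mgraph G" "uniformly_locally_finite G" "x \<in> verts G"
  shows "finite (neighbours G x)" "neighbours G x \<subseteq> verts G"
proof -
  have "finite (ends G a) \<and> ends G a \<subseteq> verts G" if "a \<in> edges G" for a
    using assms(1) that unfolding wf_mgraph_def by fastforce
  moreover have "finite (incident G x)"
    using assms(2,3) by (auto simp: uniformly_locally_finite_def)
  ultimately show "finite (neighbours G x)" "neighbours G x \<subseteq> verts G"
    by (auto simp: neighbours_def incident_def)
qed

lemma no_edge_outside_neighbours:
  assumes "y \<notin> neighbours G x"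
  shows "{a \<in> edges G. ends G a = {x, y} \<and> P a} = {}"
  using assms by (auto simp: neighbours_def incident_def)

lemma adj_op_sum:
  assumes "wf_mgraph G" "uniformly_locally_finite G" "x \<in> verts G"
  shows "adj_op G u x = (\<Sum>y\<in>neighbours G x. adj_matrix G x y * u y)"
proof -
  have z: "adj_matrix G x y = 0" if "y \<notin> neighbours G x" for y
    using no_edge_outside_neighbours[OF that, of "\<lambda>_. True"]
    by (simp add: adj_matrix_def del: Collect_empty_eq)
  have "adj_op G u x = (\<Sum>\<^sub>\<infinity>y\<in>neighbours G x. adj_matrix G x y * u y)"
    using assms(3) finite_neighbours(2)[OF assms] z
    unfolding adj_op_def matrix_op_def by (auto intro!: infsum_cong_neutral)
  then show ?thesis using finite_neighbours(1)[OF assms] by simp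
qed

lemma color_op_sum:
  assumes "wf_mgraph G" "uniformly_locally_finite G" "x \<in> verts G"
  shows "color_op G c u x = (\<Sum>y\<in>neighbours G x. color_matrix G c x y * u y)"
proof -
  have z: "color_matrix G c x y = 0" if "y \<notin> neighbours G x" for y
    using no_edge_outside_neighbours[OF that, of "\<lambda>a. color G a = c"]
    by (simp add: color_matrix_def del: Collect_empty_eq)
  have "color_op G c u x = (\<Sum>\<^sub>\<infinity>y\<in>neighbours G x. color_matrix G c x y * u y)"
    using assms(3) finite_neighbours(2)[OF assms] z
    unfolding color_op_def matrix_op_def by (auto intro!: infsum_cong_neutral)
  then show ?thesis using finite_neighbours(1)[OF assms] by simp
qed

lemma adj_op_cong: "(\<And>y. y \<in> verts G \<Longrightarrow> u y = w y) \<Longrightarrow> adj_op G u x = adj_op G w x"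
  by (auto simp: adj_op_def matrix_op_def intro!: infsum_cong)

section \<open>First-hitting series of a rooted graph\<close>

text \<open>The adjacency operator acting on vectors of power series, coefficient by coefficient. Since rows are
finite it is linear over power series and commutes with substitution; this is what allows
series to be multiplied and composed inside one-step recursions.\<close>

definition adj_fps ::
  "('v, 'e, 'm) mgraph_scheme \<Rightarrow> ('v \<Rightarrow> complex fps) \<Rightarrow> 'v \<Rightarrow> complex fps" where
  "adj_fps G U x = Abs_fps (\<lambda>n. adj_op G (\<lambda>y. fps_nth (U y) n) x)"

lemma adj_fps_nth: "fps_nth (adj_fps G U x) n = adj_op G (\<lambda>y. fps_nth (U y) n) x"
  by (simp add: adj_fps_def)

lemma adj_fps_cong: "(\<And>y. y \<in> verts G \<Longrightarrow> U y = W y) \<Longrightarrow> adj_fps G U x = adj_fps G W x"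
  unfolding adj_fps_def by (intro arg_cong[where f = Abs_fps] ext adj_op_cong) simp

lemma adj_fps_sum:
  assumes "wf_mgraph G" "uniformly_locally_finite G" "x \<in> verts G"
  shows "adj_fps G U x = (\<Sum>y\<in>neighbours G x. fps_const (adj_matrix G x y) * U y)"
  by (rule fps_ext) (simp add: adj_fps_nth adj_op_sum[OF assms] fps_sum_nth)

lemma adj_fps_mult_right:
  assumes "wf_mgraph G" "uniformly_locally_finite G" "x \<in> verts G"
  shows "adj_fps G (\<lambda>y. U y * c) x = adj_fps G U x * c"
  by (simp add: adj_fps_sum[OF assms] sum_distrib_right mult.assoc)

lemma adj_fps_compose:
  assumes "wf_mgraph G" "uniformly_locally_finite G" "x \<in> verts G" "fps_nth a 0 = 0"
  shows "adj_fps G (\<lambda>y. U y oo a) x = adj_fps G U x oo a"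
  by (simp add: adj_fps_sum[OF assms(1-3)] fps_compose_sum_distrib fps_compose_mult_distrib[OF assms(4)])

text \<open>\<open>first_hit G r n x\<close> is the number of walks of length \<open>n + 1\<close> from \<open>x\<close> that are at \<open>r\<close> at their end and at
no intermediate time; the start does not count as a visit, so \<open>x = r\<close> gives first returns. The shift by one
removes the factor \<open>z\<close> that all these counts share, and with it every division by an \<open>\<eta>\<close>-series.\<close>

primrec first_hit :: "('v, 'e, 'm) mgraph_scheme \<Rightarrow> 'v \<Rightarrow> nat \<Rightarrow> 'v \<Rightarrow> complex" where
  "first_hit G r 0 = adj_op G (delta r)"
| "first_hit G r (Suc n) = adj_op G (\<lambda>y. if y = r then 0 else first_hit G r n y)"

definition hit_series :: "('v, 'e, 'm) mgraph_scheme \<Rightarrow> 'v \<Rightarrow> 'v \<Rightarrow> complex fps" where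
  "hit_series G r x = Abs_fps (\<lambda>n. first_hit G r n x)"

lemma hit_series_eq:
  "hit_series G r x = adj_fps G (\<lambda>y. if y = r then 1 else fps_X * hit_series G r y) x"
proof (rule fps_ext)
  fix n
  show "fps_nth (hit_series G r x) n =
    fps_nth (adj_fps G (\<lambda>y. if y = r then 1 else fps_X * hit_series G r y) x) n"
    by (cases n) (auto simp: adj_fps_nth hit_series_def delta_def intro!: arg_cong[where f = "\<lambda>u. adj_op G u x"])
qed

text \<open>The first-step equation, followed by an arbitrary continuation \<open>c\<close> once \<open>r\<close> has been reached.\<close>

lemma hit_series_eq_mult:
  assumes "wf_mgraph G" "uniformly_locally_finite G" "x \<in> verts G"
  shows "adj_fps G (\<lambda>y. if y = r then c else fps_X * hit_series G r y * c) x = hit_series G r x * c"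
  unfolding hit_series_eq[of G r x] adj_fps_mult_right[OF assms, symmetric]
  by (intro adj_fps_cong) simp

text \<open>The same equation when each step is weighted by the series \<open>a\<close>, as happens when every step of a walk on
the spine is followed by an excursion counted by \<open>a\<close>.\<close>

lemma hit_series_eq_compose:
  assumes "wf_mgraph G" "uniformly_locally_finite G" "x \<in> verts G" "fps_nth a 0 = 0"
  shows "adj_fps G (\<lambda>y. if y = r then c else a * (hit_series G r y oo a) * c) x = (hit_series G r x oo a) * c"
  unfolding hit_series_eq[of G r x] adj_fps_compose[OF assms, symmetric] adj_fps_mult_right[OF assms(1-3), symmetric]
  by (intro adj_fps_cong) (simp add: fps_compose_mult_distrib[OF assms(4)] assms(4))

lemma vector_state_eq:
  assumes "e \<in> V"
  shows "vector_state V e T = T (delta e) e"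
proof -
  have "vector_state V e T = (\<Sum>\<^sub>\<infinity>x\<in>{e}. T (delta e) x)"
    unfolding vector_state_def l2_inner_def using assms
    by (intro infsum_cong_neutral) (auto simp: delta_def split: if_splits)
  then show ?thesis by simp
qed

text \<open>In this form the claim about \<open>\<eta>\<close> is the renewal equation \<open>M = 1 + h M\<close>: a closed walk is
empty or consists of a first return and a closed walk.\<close>

lemma eta_series_eqI:
  assumes "Abs_fps m * (1 - h) = 1" "m 0 = 1" "fps_nth h 0 = 0"
  shows "eta_series m = h"
proof -
  have "psi_series m = Abs_fps m - 1"
    using assms(2) by (intro fps_ext) (simp add: psi_series_def)
  then have "psi_series m * (1 - h) = Abs_fps m * (1 - h) - (1 - h)"
    by (simp add: left_diff_distrib)
  then have "h = psi_series m * (1 - h)" using assms(1) by simp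
  moreover have "1 - h \<noteq> 0" using assms(3) by auto
  ultimately have "psi_series m = h / (1 - h)" by (metis nonzero_mult_div_cancel_right)
  with assms(3) show ?thesis by (simp add: eta_series_eq_iff)
qed

text \<open>The moments at all vertices together solve \<open>Q = delta r + z A Q\<close>. A walk from \<open>x\<close> to \<open>r\<close> splits at its first
visit to \<open>r\<close> after time 0, which suggests \<open>Q x = delta r x + z (hit_series G r x) M\<close>; at \<open>x = r\<close> this is the
renewal equation.\<close>

lemma eta_spectral_distr:
  assumes G: "wf_mgraph G" "uniformly_locally_finite G" and r: "r \<in> verts G"
  shows "eta (spectral_distr G r) = fps_X * hit_series G r r"
proof -
  define h where "h = fps_X * hit_series G r r"
  define M where "M = inverse (1 - h)"
  have h0: "fps_nth h 0 = 0" by (simp add: h_def)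
  then have M: "M * (1 - h) = 1" by (simp add: M_def inverse_mult_eq_1)
  define Q where "Q x = (if x = r then 1 else 0) + fps_X * hit_series G r x * M" for x
  have Qr: "Q r = M" using M by (simp add: Q_def h_def algebra_simps)
  have step: "adj_fps G Q x = hit_series G r x * M" if "x \<in> verts G" for x
    unfolding hit_series_eq_mult[OF G that, symmetric]
    by (intro adj_fps_cong) (auto simp: Qr, simp add: Q_def)
  have pow: "(adj_op G ^^ n) (delta r) x = fps_nth (Q x) n" if "x \<in> verts G" for n x
    using that
  proof (induction n arbitrary: x)
    case 0
    then show ?case by (simp add: Q_def delta_def mult.assoc)
  next
    case (Suc n)
    have "(adj_op G ^^ Suc n) (delta r) x = fps_nth (adj_fps G Q x) n"
      using Suc.IH by (auto simp: adj_fps_nth intro!: adj_op_cong)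
    also have "\<dots> = fps_nth (Q x) (Suc n)"
      using step[OF Suc.prems] by (simp add: Q_def mult.assoc)
    finally show ?case .
  qed
  have m: "moment (spectral_distr G r) n = fps_nth M n" for n
    using distribution_spectral_distr(2)[OF r] by (simp add: vector_state_eq[OF r] pow[OF r] Qr)
  have "Abs_fps (moment (spectral_distr G r)) = M" by (rule fps_ext) (simp add: m)
  moreover have "moment (spectral_distr G r) 0 = 1" using h0 by (simp add: m M_def)
  ultimately show ?thesis using M h0 by (auto simp: eta_def h_def intro: eta_series_eqI)
qed

section \<open>Alternating walks by number of returns\<close>

text \<open>Alternating walks from \<open>v\<close> to \<open>r\<close> with \<open>m\<close> edges, the first of color \<open>c\<close>, and with \<open>j\<close> returns to \<open>r\<close>. The
general \<open>j\<close>, \<open>c\<close> and \<open>v\<close> are needed since removing the first edge of a d-walk changes all three.\<close>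

definition alt_walks ::
  "('v, 'e, 'm) cgraph_scheme \<Rightarrow> 'v \<Rightarrow> nat \<Rightarrow> nat \<Rightarrow> nat \<Rightarrow> 'v \<Rightarrow> ('v list \<times> 'e list) set" where
  "alt_walks G r c j m v = {(xs, as). walk G (xs, as) \<and> alternating G (xs, as) \<and> length as = m \<and>
     hd xs = v \<and> last xs = r \<and> (as \<noteq> [] \<longrightarrow> color G (hd as) = c) \<and> card (returns r (xs, as)) = j}"

lemma returns_Nil [simp]: "returns r (xs, []) = {}"
  by (auto simp: returns_def)

lemma alt_d_walks_eq: "alt_d_walks G m r = alt_walks G r 1 2 m r"
proof -
  have "as \<noteq> []" if "card (returns r (xs, as)) = 2" for xs and as :: "'b list"
    using that by auto
  then show ?thesis by (auto simp: alt_d_walks_def alt_walks_def d_walk_def)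
qed

lemma walk_Cons:
  assumes "xs \<noteq> []"
  shows "walk G (v # xs, a # as) \<longleftrightarrow>
    v \<in> verts G \<and> a \<in> edges G \<and> ends G a = {v, hd xs} \<and> walk G (xs, as)"
  using assms by (auto simp: walk_def All_less_Suc2 hd_conv_nth)

lemma alternating_Cons:
  "alternating G (v # xs, a # as) \<longleftrightarrow>
    (as \<noteq> [] \<longrightarrow> color G a \<noteq> color G (hd as)) \<and> alternating G (xs, as)"
proof -
  have split: "(\<forall>i. P i) \<longleftrightarrow> P 0 \<and> (\<forall>i. P (Suc i))" for P :: "nat \<Rightarrow> bool"
    by (metis not0_implies_Suc)
  have "(\<forall>i. Suc i < length (a # as) \<longrightarrow> color G ((a # as) ! i) \<noteq> color G ((a # as) ! Suc i)) \<longleftrightarrow>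
    (0 < length as \<longrightarrow> color G a \<noteq> color G (as ! 0)) \<and>
    (\<forall>i. Suc i < length as \<longrightarrow> color G (as ! i) \<noteq> color G (as ! Suc i))"
    by (subst split) auto
  then show ?thesis by (auto simp: alternating_def hd_conv_nth)
qed

lemma card_returns_Cons:
  assumes "xs \<noteq> []"
  shows "card (returns r (v # xs, a # as)) = (if hd xs = r then 1 else 0) + card (returns r (xs, as))"
proof -
  have "returns r (v # xs, a # as) = (if hd xs = r then {1} else {}) \<union> Suc ` returns r (xs, as)"
  proof (rule set_eqI)
    fix i
    show "i \<in> returns r (v # xs, a # as) \<longleftrightarrow>
      i \<in> (if hd xs = r then {1} else {}) \<union> Suc ` returns r (xs, as)"
    proof (cases i)
      case (Suc k)
      then show ?thesis using assms
        by (cases k) (auto simp: returns_def hd_conv_nth image_iff)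
    qed (auto simp: returns_def)
  qed
  moreover have "finite (returns r (xs, as))" by (auto simp: returns_def)
  moreover have "1 \<notin> Suc ` returns r (xs, as)" by (auto simp: returns_def)
  ultimately show ?thesis by (simp add: card_image)
qed

lemma alt_walks_0:
  "alt_walks G r c j 0 v = (if v \<in> verts G \<and> v = r \<and> j = 0 then {([v], [])} else {})"
  by (auto simp: alt_walks_def walk_def alternating_def length_Suc_conv)

lemma alt_walks_no_return:
  assumes "m > 0"
  shows "alt_walks G r c 0 m v = {}"
proof -
  have False if "(xs, as) \<in> alt_walks G r c 0 m v" for xs as
  proof -
    have xs: "length xs = Suc m" "length as = m" "last xs = r" "returns r (xs, as) = {}"
      using that by (auto simp: alt_walks_def walk_def returns_def)
    then have "m \<in> returns r (xs, as)"
      using assms by (simp add: returns_def last_conv_nth flip: length_greater_0_conv)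
    with xs show False by simp
  qed
  then show ?thesis by auto
qed

text \<open>What may remain of a walk in \<open>alt_walks G r c j (Suc m) v\<close> after a first edge leading to \<open>w\<close>. Arriving at
\<open>r\<close> uses up one return, and \<open>3 - c\<close> is the other color.\<close>

definition tail_walks ::
  "('v, 'e, 'm) cgraph_scheme \<Rightarrow> 'v \<Rightarrow> nat \<Rightarrow> nat \<Rightarrow> nat \<Rightarrow> 'v \<Rightarrow> ('v list \<times> 'e list) set" where
  "tail_walks G r c j m w =
     (if w = r then if j = 0 then {} else alt_walks G r (3 - c) (j - 1) m w
      else alt_walks G r (3 - c) j m w)"

lemma alt_walks_Suc:
  assumes "\<forall>a\<in>edges G. color G a \<in> {1, 2}" "c \<in> {1, 2}" "v \<in> verts G"
  shows "alt_walks G r c j (Suc m) v = (\<Union>w\<in>neighbours G v. (\<lambda>(a, xs, as). (v # xs, a # as)) `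
    ({a \<in> edges G. ends G a = {v, w} \<and> color G a = c} \<times> tail_walks G r c j m w))"
    (is "?L = ?R")
proof -
  \<comment> \<open>With only two colors, differing from a given one determines the color.\<close>
  have other: "color G a \<noteq> color G b \<longleftrightarrow> color G b = 3 - c"
    if "a \<in> edges G" "b \<in> edges G" "color G a = c" for a b
  proof -
    have "color G a = 1 \<or> color G a = 2" "color G b = 1 \<or> color G b = 2"
      using assms(1) that(1,2) by auto
    with that(3) show ?thesis by (elim disjE) simp_all
  qed
  have tail: "(ys, bs) \<in> tail_walks G r c j m w \<longleftrightarrow>
      walk G (ys, bs) \<and> alternating G (ys, bs) \<and> length bs = m \<and> hd ys = w \<and> last ys = r \<and>
      (bs \<noteq> [] \<longrightarrow> color G (hd bs) = 3 - c) \<and>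
      (if w = r then 1 else 0) + card (returns r (ys, bs)) = j" for ys bs w
    by (auto simp: tail_walks_def alt_walks_def)
  have key: "(v # ys, a # bs) \<in> ?L \<longleftrightarrow>
      a \<in> edges G \<and> ends G a = {v, hd ys} \<and> color G a = c \<and> (ys, bs) \<in> tail_walks G r c j m (hd ys)"
    if "ys \<noteq> []" for ys a bs
  proof -
    have "hd bs \<in> edges G" if "walk G (ys, bs)" "bs \<noteq> []"
      using that by (auto simp: walk_def hd_conv_nth)
    then have "(bs \<noteq> [] \<longrightarrow> color G a \<noteq> color G (hd bs)) \<longleftrightarrow> (bs \<noteq> [] \<longrightarrow> color G (hd bs) = 3 - c)"
      if "a \<in> edges G" "color G a = c" "walk G (ys, bs)"
      using other that by blast
    moreover have "(v # ys, a # bs) \<in> ?L \<longleftrightarrow>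
      (a \<in> edges G \<and> ends G a = {v, hd ys} \<and> walk G (ys, bs)) \<and>
      ((bs \<noteq> [] \<longrightarrow> color G a \<noteq> color G (hd bs)) \<and> alternating G (ys, bs)) \<and> length bs = m \<and>
      last ys = r \<and> color G a = c \<and>
      (if hd ys = r then 1 else 0) + card (returns r (ys, bs)) = j"
      using that assms(3) by (simp add: alt_walks_def walk_Cons alternating_Cons card_returns_Cons)
    ultimately show ?thesis unfolding tail by blast
  qed
  show ?thesis
  proof (intro equalityI subsetI)
    fix p assume p: "p \<in> ?L"
    then obtain ys a bs where p': "p = (v # ys, a # bs)" "ys \<noteq> []"
      by (auto simp: alt_walks_def walk_def length_Suc_conv)
    with p key have k: "a \<in> edges G" "ends G a = {v, hd ys}" "color G a = c"
      "(ys, bs) \<in> tail_walks G r c j m (hd ys)" by auto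
    then have "hd ys \<in> neighbours G v" by (auto simp: neighbours_def incident_def)
    with k p' show "p \<in> ?R" by force
  next
    fix p assume "p \<in> ?R"
    then obtain w a ys bs where k: "p = (v # ys, a # bs)" "a \<in> edges G" "ends G a = {v, w}"
      "color G a = c" "(ys, bs) \<in> tail_walks G r c j m w" by auto
    then have "hd ys = w" "ys \<noteq> []" unfolding tail by (auto simp: walk_def)
    with k key show "p \<in> ?L" by auto
  qed
qed

lemma finite_colored_edges:
  assumes "uniformly_locally_finite G" "v \<in> verts G"
  shows "finite {a \<in> edges G. ends G a = {v, w} \<and> color G a = c}"
proof -
  have "finite (incident G v)" using assms by (auto simp: uniformly_locally_finite_def)
  then show ?thesis by (rule rev_finite_subset) (auto simp: incident_def)
qed

lemma finite_alt_walks: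
  assumes G: "wf_mgraph G" "uniformly_locally_finite G"
    and col: "\<forall>a\<in>edges G. color G a \<in> {1, 2}" and "c \<in> {1, 2}" "v \<in> verts G"
  shows "finite (alt_walks G r c j m v)"
  using assms(4,5)
proof (induction m arbitrary: c j v)
  case 0
  then show ?case by (simp add: alt_walks_0)
next
  case (Suc m)
  have "finite (tail_walks G r c j m w)" if "w \<in> neighbours G v" for w
  proof -
    have "3 - c \<in> {1, 2}" "w \<in> verts G"
      using that finite_neighbours(2)[OF G] Suc.prems by auto
    note Suc.IH[OF this]
    then show ?thesis unfolding tail_walks_def by (cases "w = r"; cases "j = 0") simp_all
  qed
  then show ?case
    unfolding alt_walks_Suc[OF col Suc.prems]
    using finite_neighbours(1)[OF G Suc.prems(2)] finite_colored_edges[OF G(2) Suc.prems(2)] by auto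
qed

text \<open>Counting by the first edge turns the numbers of alternating walks into a recursion by the color
operators.\<close>

lemma card_alt_walks_Suc:
  assumes G: "wf_mgraph G" "uniformly_locally_finite G"
    and col: "\<forall>a\<in>edges G. color G a \<in> {1, 2}" and c: "c \<in> {1, 2}" and v: "v \<in> verts G"
  shows "of_nat (card (alt_walks G r c j (Suc m) v)) =
    color_op G c (\<lambda>w. of_nat (card (tail_walks G r c j m w))) v"
proof -
  let ?E = "\<lambda>w. {a \<in> edges G. ends G a = {v, w} \<and> color G a = c}"
  let ?f = "\<lambda>(a, xs, as). (v # xs, a # as)"
  let ?W = "\<lambda>w. ?f ` (?E w \<times> tail_walks G r c j m w)"
  have fin: "finite (tail_walks G r c j m w)" if "w \<in> neighbours G v" for w
  proof -
    have "3 - c \<in> {1, 2}" "w \<in> verts G"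
      using that finite_neighbours(2)[OF G v] c by auto
    note finite_alt_walks[OF G col this]
    then show ?thesis unfolding tail_walks_def by (cases "w = r"; cases "j = 0") simp_all
  qed
  have disj: "?W w \<inter> ?W w' = {}" if "w \<noteq> w'" for w w'
    using that by (auto simp: tail_walks_def alt_walks_def split: if_splits)
  have "card (alt_walks G r c j (Suc m) v) = (\<Sum>w\<in>neighbours G v. card (?W w))"
    unfolding alt_walks_Suc[OF col c v]
    using finite_neighbours(1)[OF G v] fin finite_colored_edges[OF G(2) v] disj
    by (intro card_UN_disjoint) auto
  also have "\<dots> = (\<Sum>w\<in>neighbours G v. card (?E w) * card (tail_walks G r c j m w))"
    by (intro sum.cong refl) (subst card_image, auto simp: inj_on_def card_cartesian_product)
  finally show ?thesis
    by (simp add: color_op_sum[OF G v] color_matrix_def)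
qed

section \<open>Rows of the color operators on a product\<close>

text \<open>A row of a matrix that is supported on an embedded copy of \<open>W\<close> acts like the corresponding row on \<open>W\<close>.
The rows of all graph constructions below are of this kind, so that no finiteness is needed to compute
them.\<close>

lemma matrix_op_reindex:
  assumes "inj_on \<phi> W" "\<phi> ` W \<subseteq> V" "v \<in> V" "w \<in> W"
    and "\<And>y. y \<in> W \<Longrightarrow> A v (\<phi> y) = B w y" "\<And>z. z \<in> V - \<phi> ` W \<Longrightarrow> A v z = 0"
  shows "matrix_op V A u v = matrix_op W B (\<lambda>y. u (\<phi> y)) w"
proof -
  have "(\<Sum>\<^sub>\<infinity>z\<in>V. A v z * u z) = (\<Sum>\<^sub>\<infinity>z\<in>\<phi> ` W. A v z * u z)"
    using assms(2,6) by (intro infsum_cong_neutral) auto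
  also have "\<dots> = (\<Sum>\<^sub>\<infinity>y\<in>W. B w y * u (\<phi> y))"
    using assms(5) by (subst infsum_reindex[OF assms(1)]) (auto intro!: infsum_cong)
  finally show ?thesis using assms(3,4) by (simp add: matrix_op_def)
qed

lemma color_op_attach_1:
  assumes "x \<in> verts G1" "\<And>x. x \<in> verts G1 \<Longrightarrow> r x \<in> verts G2"
  shows "color_op (attach G1 r G2) 1 u (x, r x) = adj_op G1 (\<lambda>x'. u (x', r x')) x"
  unfolding color_op_def adj_op_def
proof (rule matrix_op_reindex)
  have inj: "inj (\<lambda>x. (x, r x))" by (simp add: inj_on_def)
  show "color_matrix (attach G1 r G2) 1 (x, r x) (x', r x') = adj_matrix G1 x x'" for x'
  proof -
    have "(\<lambda>x. (x, r x)) ` E = {(x, r x), (x', r x')} \<longleftrightarrow> E = {x, x'}" for E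
      using inj_image_eq_iff[OF inj, of E "{x, x'}"] by simp
    then have "{a \<in> edges (attach G1 r G2). ends (attach G1 r G2) a = {(x, r x), (x', r x')} \<and>
        color (attach G1 r G2) a = 1} = Inl ` {a \<in> edges G1. ends G1 a = {x, x'}}"
      by (auto simp: attach_def)
    then show ?thesis by (simp add: color_matrix_def adj_matrix_def card_image)
  qed
  fix q assume "q \<in> verts (attach G1 r G2) - (\<lambda>x'. (x', r x')) ` verts G1"
  then obtain x' y' where q: "q = (x', y')" "y' \<noteq> r x'" by (auto simp: attach_def)
  then have "{a \<in> edges (attach G1 r G2). ends (attach G1 r G2) a = {(x, r x), q} \<and>
        color (attach G1 r G2) a = 1} = {}"
    by (auto simp: attach_def)
  then show "color_matrix (attach G1 r G2) 1 (x, r x) q = 0"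
    unfolding color_matrix_def by (simp only: card.empty of_nat_0)
qed (use assms in \<open>auto simp: attach_def inj_on_def\<close>)

lemma color_op_attach_2:
  assumes "x \<in> verts G1" "y \<in> verts G2"
  shows "color_op (attach G1 r G2) 2 u (x, y) = adj_op G2 (\<lambda>y'. u (x, y')) y"
  unfolding color_op_def adj_op_def
proof (rule matrix_op_reindex)
  have inj: "inj (Pair x)" by (simp add: inj_on_def)
  show "color_matrix (attach G1 r G2) 2 (x, y) (x, y') = adj_matrix G2 y y'" for y'
  proof -
    have "Pair z ` E = {(x, y), (x, y')} \<longleftrightarrow> z = x \<and> E = {y, y'}" for z E
    proof (cases "z = x")
      case True
      have "{(x, y), (x, y')} = Pair x ` {y, y'}" by simp
      then show ?thesis using True by (simp only: inj_image_eq_iff[OF inj] simp_thms)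
    next
      case False
      then have "(x, y) \<notin> Pair z ` E" by auto
      then show ?thesis using False by auto
    qed
    then have "{a \<in> edges (attach G1 r G2). ends (attach G1 r G2) a = {(x, y), (x, y')} \<and>
        color (attach G1 r G2) a = 2} = (\<lambda>b. Inr (x, b)) ` {b \<in> edges G2. ends G2 b = {y, y'}}"
      using assms by (auto simp: attach_def)
    then show ?thesis by (simp add: color_matrix_def adj_matrix_def card_image inj_on_def)
  qed
  fix q assume "q \<in> verts (attach G1 r G2) - Pair x ` verts G2"
  then obtain x' y' where q: "q = (x', y')" "x' \<noteq> x" by (auto simp: attach_def)
  have "Pair z ` E \<noteq> {(x, y), q}" for z E
  proof
    assume "Pair z ` E = {(x, y), q}"
    then have "(x, y) \<in> Pair z ` E" "q \<in> Pair z ` E" by simp_all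
    with q show False by auto
  qed
  then have "{a \<in> edges (attach G1 r G2). ends (attach G1 r G2) a = {(x, y), q} \<and>
        color (attach G1 r G2) a = 2} = {}"
    by (auto simp: attach_def)
  then show "color_matrix (attach G1 r G2) 2 (x, y) q = 0"
    unfolding color_matrix_def by (simp only: card.empty of_nat_0)
qed (use assms in \<open>auto simp: attach_def inj_on_def\<close>)

lemma color_op_add_loops_other:
  assumes "v \<in> verts G" "c \<noteq> 1 \<or> v \<notin> S"
  shows "color_op (add_loops G S) c u v = color_op G c u v"
  unfolding color_op_def
proof (rule matrix_op_reindex[where \<phi> = "\<lambda>y. y"])
  show "color_matrix (add_loops G S) c v y = color_matrix G c v y" for y
  proof -
    have "{a \<in> edges (add_loops G S). ends (add_loops G S) a = {v, y} \<and> color (add_loops G S) a = c}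
        = Inl ` {a \<in> edges G. ends G a = {v, y} \<and> color G a = c}" (is "?L = ?R")
    proof (rule set_eqI)
      fix a
      show "a \<in> ?L \<longleftrightarrow> a \<in> ?R"
        using assms(2) by (cases a) (auto simp: add_loops_def singleton_insert_inj_eq)
    qed
    then show ?thesis by (simp add: color_matrix_def card_image)
  qed
qed (use assms in \<open>auto simp: add_loops_def\<close>)

lemma color_op_add_loops_loop:
  assumes "v \<in> verts G" "v \<in> S" "\<And>a. a \<in> incident G v \<Longrightarrow> color G a \<noteq> 1"
  shows "color_op (add_loops G S) 1 u v = u v"
proof -
  have m: "color_matrix (add_loops G S) 1 v y = (if y = v then 1 else 0)" for y
  proof -
    have "{a \<in> edges (add_loops G S). ends (add_loops G S) a = {v, y} \<and> color (add_loops G S) a = 1}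
        = (if y = v then {Inr v} else {})"
      using assms by (auto simp: add_loops_def incident_def)
    then show ?thesis by (simp add: color_matrix_def)
  qed
  have "color_op (add_loops G S) 1 u v = matrix_op {v} (\<lambda>_ _. 1) u v"
    unfolding color_op_def
    by (rule matrix_op_reindex[where \<phi> = "\<lambda>y. y"]) (use assms m in \<open>auto simp: add_loops_def\<close>)
  then show ?thesis by (simp add: matrix_op_def)
qed

text \<open>If \<open>H\<close> is embedded in \<open>G\<close> and \<open>G\<close> has no further edges at the image of \<open>x\<close>, then the row at \<open>x\<close> does not notice
the rest of \<open>G\<close>.\<close>

lemma color_op_component:
  assumes H: "wf_mgraph H" "x \<in> verts H" and \<phi>: "inj \<phi>" "\<phi> ` verts H \<subseteq> verts G" and \<psi>: "inj \<psi>"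
    and edge: "\<And>a. ends G (\<psi> a) = \<phi> ` ends H a" "\<And>a. color G (\<psi> a) = color H a"
    and incident: "incident G (\<phi> x) = \<psi> ` incident H x"
  shows "color_op G c u (\<phi> x) = color_op H c (\<lambda>y. u (\<phi> y)) x"
  unfolding color_op_def
proof (rule matrix_op_reindex)
  have inc: "a \<in> edges G \<and> \<phi> x \<in> ends G a \<longleftrightarrow> (\<exists>b. a = \<psi> b \<and> b \<in> edges H \<and> x \<in> ends H b)" for a
    using incident unfolding incident_def set_eq_iff image_iff by blast
  have row: "{a \<in> edges G. ends G a = {\<phi> x, w} \<and> color G a = c} =
      \<psi> ` {b \<in> edges H. \<phi> ` ends H b = {\<phi> x, w} \<and> color H b = c}" (is "?L = ?R") for w
  proof (intro equalityI subsetI)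
    fix a assume a: "a \<in> ?L"
    then obtain b where "a = \<psi> b" "b \<in> edges H" using inc[of a] by auto
    with a show "a \<in> ?R" by (auto simp: edge)
  next
    fix a assume "a \<in> ?R"
    then obtain b where b: "a = \<psi> b" "b \<in> edges H" "\<phi> ` ends H b = {\<phi> x, w}" "color H b = c" by auto
    then have "\<phi> x \<in> \<phi> ` ends H b" by simp
    then have "x \<in> ends H b" by (simp only: inj_image_mem_iff[OF \<phi>(1)])
    with b show "a \<in> ?L" using inc[of a] by (auto simp: edge)
  qed
  show "color_matrix G c (\<phi> x) (\<phi> y) = color_matrix H c x y" for y
  proof -
    have "\<phi> ` E = {\<phi> x, \<phi> y} \<longleftrightarrow> E = {x, y}" for E
      using inj_image_eq_iff[OF \<phi>(1), of E "{x, y}"] by simp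
    then show ?thesis
      using \<psi> by (simp add: color_matrix_def row card_image inj_on_subset[OF _ subset_UNIV])
  qed
  fix z assume z: "z \<in> verts G - \<phi> ` verts H"
  have "ends H b \<subseteq> verts H" if "b \<in> edges H" for b
    using H(1) that unfolding wf_mgraph_def by fastforce
  then have "\<phi> ` ends H b \<noteq> {\<phi> x, z}" if "b \<in> edges H" for b
    using z that by blast
  then have "{a \<in> edges G. ends G a = {\<phi> x, z} \<and> color G a = c} = {}"
    unfolding row by blast
  then show "color_matrix G c (\<phi> x) z = 0"
    unfolding color_matrix_def by (simp only: card.empty of_nat_0)
qed (use H \<phi> in \<open>auto intro: inj_on_subset\<close>)

lemma color_op_disjoint_union:
  assumes "wf_mgraph G" "wf_mgraph H"
  shows "x \<in> verts G \<Longrightarrow> color_op (disjoint_union G H) c u (Inl x) = color_op G c (\<lambda>y. u (Inl y)) x"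
    and "y \<in> verts H \<Longrightarrow> color_op (disjoint_union G H) c u (Inr y) = color_op H c (\<lambda>y. u (Inr y)) y"
  using assms
  by (auto intro!: color_op_component[where \<psi> = Inl] color_op_component[where \<psi> = Inr]
      simp: disjoint_union_def incident_def)

definition looped_attach ::
  "('v1, 'e1) mgraph \<Rightarrow> ('v1 \<Rightarrow> 'v2) \<Rightarrow> ('v2, 'e2) mgraph \<Rightarrow>
   ('v1 \<times> 'v2, ('e1 + 'v1 \<times> 'e2) + 'v1 \<times> 'v2) cgraph" where
  "looped_attach G1 r G2 =
     add_loops (attach G1 r G2) {(x, y). x \<in> verts G1 \<and> y \<in> verts G2 \<and> y \<noteq> r x}"

text \<open>The alternation between the spine and the copies of \<open>G2\<close>, in terms of operators: color 1 acts as \<open>G1\<close> on the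
spine and as the identity elsewhere, and color 2 acts as \<open>G2\<close> within each copy.\<close>

lemma color_op_looped_attach:
  assumes "x \<in> verts G1" "y \<in> verts G2" "\<And>x. x \<in> verts G1 \<Longrightarrow> r x \<in> verts G2"
  shows "color_op (looped_attach G1 r G2) 1 u (x, y) =
      (if y = r x then adj_op G1 (\<lambda>x'. u (x', r x')) x else u (x, y))"
    and "color_op (looped_attach G1 r G2) 2 u (x, y) = adj_op G2 (\<lambda>y'. u (x, y')) y"
proof -
  let ?S = "{(x, y). x \<in> verts G1 \<and> y \<in> verts G2 \<and> y \<noteq> r x}"
  have v: "(x, y) \<in> verts (attach G1 r G2)" using assms by (simp add: attach_def)
  show "color_op (looped_attach G1 r G2) 1 u (x, y) =
      (if y = r x then adj_op G1 (\<lambda>x'. u (x', r x')) x else u (x, y))"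
  proof (cases "y = r x")
    case True
    then show ?thesis
      unfolding looped_attach_def
      using color_op_add_loops_other[OF v, where c = 1 and S = ?S and u = u] color_op_attach_1[OF assms(1,3), where u = u] by simp
  next
    case False
    have "color (attach G1 r G2) a \<noteq> 1" if "a \<in> incident (attach G1 r G2) (x, y)" for a
      using that False by (auto simp: incident_def attach_def)
    then show ?thesis
      unfolding looped_attach_def
      using color_op_add_loops_loop[OF v, where S = ?S and u = u] False assms(1,2) by simp
  qed
  show "color_op (looped_attach G1 r G2) 2 u (x, y) = adj_op G2 (\<lambda>y'. u (x, y')) y"
    unfolding looped_attach_def
    using color_op_add_loops_other[OF v, where c = 2 and S = ?S and u = u] color_op_attach_2[OF assms(1,2), where r = r and u = u] by simp
qed

lemma wf_looped_attach:
  assumes "wf_mgraph G1" "uniformly_locally_finite G1" "wf_mgraph G2" "uniformly_locally_finite G2"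
    and "\<And>x. x \<in> verts G1 \<Longrightarrow> r x \<in> verts G2"
  shows "wf_mgraph (looped_attach G1 r G2)"
  unfolding looped_attach_def
  by (rule add_loops_graph(1)[OF attach_graph[OF assms]]) (auto simp: attach_def)

lemma verts_disjoint_unionI:
  "x \<in> verts G \<Longrightarrow> Inl x \<in> verts (disjoint_union G H)"
  "y \<in> verts H \<Longrightarrow> Inr y \<in> verts (disjoint_union G H)"
  by (auto simp: disjoint_union_def)

section \<open>The component of a root\<close>

text \<open>One of the two summands of the c-comb loop product, seen inside the whole graph \<open>G\<close> through the embedding
\<open>\<iota>\<close>. Its root is \<open>\<iota> (x0, s)\<close>. The summand of \<open>e\<close> has \<open>s = e2\<close> and \<open>t = f2\<close>, and that of \<open>f\<close> has \<open>s = t = f2\<close>;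
treating \<open>s\<close> and \<open>t\<close> as independent covers both at once.\<close>

locale loop_product_component =
  fixes G1 :: "('v1, 'e1) mgraph" and G2 :: "('v2, 'e2) mgraph" and G :: "('v, 'e) cgraph"
    and \<iota> :: "'v1 \<times> 'v2 \<Rightarrow> 'v" and x0 :: 'v1 and s t :: 'v2 and r :: "'v1 \<Rightarrow> 'v2"
  assumes G1: "wf_mgraph G1" "uniformly_locally_finite G1"
    and G2: "wf_mgraph G2" "uniformly_locally_finite G2"
    and G: "wf_mgraph G" "uniformly_locally_finite G" "\<forall>a\<in>edges G. color G a \<in> {1, 2}"
    and roots: "x0 \<in> verts G1" "s \<in> verts G2" "t \<in> verts G2"
    and r: "\<And>x. r x = (if x = x0 then s else t)"
    and inj: "inj \<iota>" and verts: "\<And>p. p \<in> verts G1 \<times> verts G2 \<Longrightarrow> \<iota> p \<in> verts G"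
    and component: "\<And>c u p. p \<in> verts G1 \<times> verts G2 \<Longrightarrow>
      color_op G c u (\<iota> p) = color_op (looped_attach G1 r G2) c (\<lambda>q. u (\<iota> q)) p"
begin

lemma r_x0: "r x0 = s" and r_other: "x \<noteq> x0 \<Longrightarrow> r x = t" and r_verts: "r x \<in> verts G2"
  using roots by (simp_all add: r)

lemma verts_iota: "x \<in> verts G1 \<Longrightarrow> y \<in> verts G2 \<Longrightarrow> \<iota> (x, y) \<in> verts G"
  by (simp add: verts)

lemma row1: "color_op G 1 u (\<iota> (x, y)) =
    (if y = r x then adj_op G1 (\<lambda>x'. u (\<iota> (x', r x'))) x else u (\<iota> (x, y)))"
  and row2: "color_op G 2 u (\<iota> (x, y)) = adj_op G2 (\<lambda>y'. u (\<iota> (x, y'))) y"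
  if "x \<in> verts G1" "y \<in> verts G2"
  using component[of "(x, y)"] color_op_looped_attach[OF that r_verts] that by simp_all

lemma iota_eq: "\<iota> p = \<iota> q \<longleftrightarrow> p = q"
  using inj by (simp add: inj_eq)

text \<open>The \<open>\<eta>\<close>-series of \<open>G2\<close> at \<open>t\<close> and \<open>s\<close>, counting excursions away from the spine by their edges of color 2.
The series \<open>spine x\<close> counts walks in \<open>G1\<close> from \<open>x\<close> to their first visit of \<open>x0\<close>, with an excursion inserted
at each intermediate vertex.\<close>

definition excursion_t :: "complex fps" where "excursion_t = fps_X * hit_series G2 t t"
definition excursion_s :: "complex fps" where "excursion_s = fps_X * hit_series G2 s s"
definition spine :: "'v1 \<Rightarrow> complex fps" where "spine x = hit_series G1 x0 x oo excursion_t"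

lemma excursion_t_0: "fps_nth excursion_t 0 = 0" and excursion_s_0: "fps_nth excursion_s 0 = 0"
  by (simp_all add: excursion_t_def excursion_s_def)

lemma spine_eq:
  assumes "x \<in> verts G1"
  shows "adj_fps G1 (\<lambda>x'. if x' = x0 then c else excursion_t * spine x' * c) x = spine x * c"
  unfolding spine_def by (rule hit_series_eq_compose[OF G1 assms excursion_t_0])

lemma first_return_at_r: "fps_X * hit_series G2 (r x) (r x) = (if x = x0 then excursion_s else excursion_t)"
  by (simp add: r_x0 r_other excursion_t_def excursion_s_def)

text \<open>In the next two lemmas, coefficients of series indexed by the product again give coefficients of such series
when a color operator is applied; with them each recursion becomes an identity between series.\<close>

lemma color_op_1_fps:
  assumes "\<And>x y. x \<in> verts G1 \<Longrightarrow> y \<in> verts G2 \<Longrightarrow> u (\<iota> (x, y)) = fps_nth (U x y) n"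
    and "x \<in> verts G1" "y \<in> verts G2"
  shows "color_op G 1 u (\<iota> (x, y)) =
    fps_nth (if y = r x then adj_fps G1 (\<lambda>x'. U x' (r x')) x else U x y) n"
  unfolding row1[OF assms(2,3)] using assms r_verts
  by (auto simp: adj_fps_nth intro!: adj_op_cong)

lemma color_op_2_fps:
  assumes "\<And>x y. x \<in> verts G1 \<Longrightarrow> y \<in> verts G2 \<Longrightarrow> u (\<iota> (x, y)) = fps_nth (U x y) n"
    and "x \<in> verts G1" "y \<in> verts G2"
  shows "color_op G 2 u (\<iota> (x, y)) = fps_nth (adj_fps G2 (U x) y) n"
  unfolding row2[OF assms(2,3)] using assms
  by (auto simp: adj_fps_nth intro!: adj_op_cong)

text \<open>The vectors \<open>Z^n (delta root)\<close> are the coefficients of the solution of \<open>Q = delta root + z R2 R1 Q\<close>. Their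
entry at \<open>(x, y)\<close> counts walks starting with color 2. If such a walk is not empty, it first hits the spine at
\<open>(x, r x)\<close>, walks along the spine up to \<open>x0\<close>, and goes on with an arbitrary closed walk, counted by \<open>M\<close>. In the proof,
\<open>Q\<close> is this guess and \<open>S\<close> is \<open>R1 Q\<close>.\<close>

lemma eta_Z:
  "eta_series (\<lambda>k. vector_state (verts G) (\<iota> (x0, s)) ((color_op G 2 \<circ> color_op G 1) ^^ k)) =
    excursion_s * spine x0"
proof -
  let ?d = "delta (\<iota> (x0, s))"
  define Z where "Z = color_op G 2 \<circ> color_op G 1"
  define M where "M = inverse (1 - excursion_s * spine x0)"
  have M: "M * (1 - excursion_s * spine x0) = 1" by (simp add: M_def inverse_mult_eq_1 excursion_s_0)
  define Q where "Q x y = (if x = x0 \<and> y = s then 1 else 0) +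
    fps_X * hit_series G2 (r x) y * (spine x * M)" for x y
  define S where "S x y = (if y = r x then spine x * M else fps_X * hit_series G2 (r x) y * (spine x * M))" for x y
  have Q_spine: "Q x (r x) = (if x = x0 then M else excursion_t * spine x * M)" for x
  proof (cases "x = x0")
    case True
    then show ?thesis
      using M first_return_at_r[of x0] by (simp add: Q_def r_x0 algebra_simps)
  next
    case False
    then show ?thesis
      using first_return_at_r[of x] by (simp add: Q_def mult.assoc)
  qed
  have S1: "(if y = r x then adj_fps G1 (\<lambda>x'. Q x' (r x')) x else Q x y) = S x y"
    if "x \<in> verts G1" for x y
  proof (cases "y = r x")
    case True
    then show ?thesis using spine_eq[OF that, of M] by (simp add: Q_spine S_def)
  next
    case False
    then show ?thesis by (auto simp: S_def Q_def r_x0)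
  qed
  have S2: "adj_fps G2 (S x) y = hit_series G2 (r x) y * (spine x * M)" if "y \<in> verts G2" for x y
    unfolding hit_series_eq_mult[OF G2 that, symmetric]
    by (intro adj_fps_cong) (simp add: S_def)
  have pow: "(Z ^^ n) ?d (\<iota> (x, y)) = fps_nth (Q x y) n" if "x \<in> verts G1" "y \<in> verts G2" for n x y
    using that
  proof (induction n arbitrary: x y)
    case 0
    then show ?case by (simp add: Q_def delta_def iota_eq mult.assoc)
  next
    case (Suc n)
    have "color_op G 1 ((Z ^^ n) ?d) (\<iota> (x, y)) = fps_nth (S x y) n"
      if "x \<in> verts G1" "y \<in> verts G2" for x y
      by (rule color_op_1_fps[where U = Q, OF Suc.IH that, unfolded S1[OF that(1)]])
    from color_op_2_fps[where u = "color_op G 1 ((Z ^^ n) ?d)" and U = S, OF this Suc.prems]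
    have "color_op G 2 (color_op G 1 ((Z ^^ n) ?d)) (\<iota> (x, y)) = fps_nth (adj_fps G2 (S x) y) n"
      by (simp only:)
    then have "(Z ^^ Suc n) ?d (\<iota> (x, y)) = fps_nth (adj_fps G2 (S x) y) n"
      by (simp add: Z_def)
    then show ?case using S2[OF Suc.prems(2)] by (simp add: Q_def mult.assoc)
  qed
  have m: "vector_state (verts G) (\<iota> (x0, s)) (Z ^^ k) = fps_nth M k" for k
    using pow[OF roots(1,2)] Q_spine[of x0] by (simp add: vector_state_eq[OF verts_iota[OF roots(1,2)]] r_x0)
  have "Abs_fps (\<lambda>k. fps_nth M k) = M" by (rule fps_ext) simp
  then show ?thesis
    unfolding m[unfolded Z_def] using M by (intro eta_series_eqI) (simp_all add: excursion_s_0 M_def)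
qed

section \<open>Counting walks with two returns\<close>

definition walk_count :: "nat \<Rightarrow> nat \<Rightarrow> nat \<Rightarrow> 'v \<Rightarrow> complex" where
  "walk_count c j m v = of_nat (card (alt_walks G (\<iota> (x0, s)) c j m v))"

lemma walk_count_Suc:
  assumes "c \<in> {1, 2}" "x \<in> verts G1" "y \<in> verts G2"
  shows "walk_count c (Suc j) (Suc m) (\<iota> (x, y)) = color_op G c
    (\<lambda>w. if w = \<iota> (x0, s) then walk_count (3 - c) j m w else walk_count (3 - c) (Suc j) m w) (\<iota> (x, y))"
  unfolding walk_count_def card_alt_walks_Suc[OF G assms(1) verts_iota[OF assms(2,3)]]
  by (intro arg_cong[where f = "\<lambda>u. color_op G c u (\<iota> (x, y))"] ext) (simp add: tail_walks_def)

text \<open>One step of the recursion for \<open>walk_count\<close>, one lemma for each color of the first edge. The root is the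
only vertex where the number of remaining returns drops. The series \<open>U\<close> counts what remains after the
first edge, as a function of the vertex reached.\<close>

lemma walk_count_1_Suc:
  assumes "\<And>x y. x \<in> verts G1 \<Longrightarrow> y \<in> verts G2 \<Longrightarrow>
      walk_count 2 (if x = x0 \<and> y = s then j else Suc j) m (\<iota> (x, y)) = fps_nth (U x y) n"
    and "x \<in> verts G1" "y \<in> verts G2"
  shows "walk_count 1 (Suc j) (Suc m) (\<iota> (x, y)) =
    fps_nth (if y = r x then adj_fps G1 (\<lambda>x'. U x' (r x')) x else U x y) n"
  unfolding walk_count_Suc[OF insertI1 assms(2,3)]
proof (rule color_op_1_fps[OF _ assms(2,3)])
  fix x y assume "x \<in> verts G1" "y \<in> verts G2"
  from assms(1)[OF this]
  show "(if \<iota> (x, y) = \<iota> (x0, s) then walk_count (3 - 1) j m (\<iota> (x, y))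
    else walk_count (3 - 1) (Suc j) m (\<iota> (x, y))) =
    fps_nth (U x y) n" by (cases "x = x0 \<and> y = s") (auto simp: iota_eq)
qed

lemma walk_count_2_Suc:
  assumes "\<And>x y. x \<in> verts G1 \<Longrightarrow> y \<in> verts G2 \<Longrightarrow>
      walk_count 1 (if x = x0 \<and> y = s then j else Suc j) m (\<iota> (x, y)) = fps_nth (U x y) n"
    and "x \<in> verts G1" "y \<in> verts G2"
  shows "walk_count 2 (Suc j) (Suc m) (\<iota> (x, y)) = fps_nth (adj_fps G2 (U x) y) n"
proof -
  have c: "2 \<in> {1, 2::nat}" by simp
  show ?thesis
    unfolding walk_count_Suc[OF c assms(2,3)]
  proof (rule color_op_2_fps[OF _ assms(2,3)])
    fix x y assume "x \<in> verts G1" "y \<in> verts G2"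
    from assms(1)[OF this]
    show "(if \<iota> (x, y) = \<iota> (x0, s) then walk_count (3 - 2) j m (\<iota> (x, y))
      else walk_count (3 - 2) (Suc j) m (\<iota> (x, y))) =
      fps_nth (U x y) n" by (cases "x = x0 \<and> y = s") (auto simp: iota_eq)
  qed
qed

lemma walk_count_0: "walk_count c (Suc j) 0 v = 0"
  by (simp add: walk_count_def alt_walks_0)

lemma walk_count_no_return: "walk_count c 0 m (\<iota> (x0, s)) = (if m = 0 then 1 else 0)"
  using verts_iota roots by (simp add: walk_count_def alt_walks_0 alt_walks_no_return)

text \<open>The numbers of walks with one and with two returns; the digit at the end of the name is the color of
the first edge. The exponent counts the edges of color 2, without the first edge if that has color 2, the
same shift as in \<open>hit_series\<close>. Walks that start with color 1 have even length and those that start with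
color 2 odd length, so all of them end with color 2. The last return is thus
made by an excursion in the copy at \<open>x0\<close>: with only one return left the walk must already be inside this
copy, and with two returns left it must not be there unless it is at the root itself.\<close>

definition one_return_1 :: "'v1 \<Rightarrow> 'v2 \<Rightarrow> complex fps" where
  "one_return_1 x y = (if x = x0 \<and> y \<noteq> s then fps_X * hit_series G2 s y else 0)"

definition one_return_2 :: "'v1 \<Rightarrow> 'v2 \<Rightarrow> complex fps" where
  "one_return_2 x y = (if x = x0 then hit_series G2 s y else 0)"

definition two_returns_1 :: "'v1 \<Rightarrow> 'v2 \<Rightarrow> complex fps" where
  "two_returns_1 x y = (if y = r x then excursion_s * spine x else if x = x0 then 0
    else fps_X * hit_series G2 t y * (excursion_s * spine x))"

definition two_returns_2 :: "'v1 \<Rightarrow> 'v2 \<Rightarrow> complex fps" where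
  "two_returns_2 x y = (if x = x0 then 0 else hit_series G2 t y * (excursion_s * spine x))"

lemma adj_fps_zero: "adj_fps H (\<lambda>y. 0) x = 0"
  by (rule fps_ext) (simp add: adj_fps_nth adj_op_def matrix_op_def)

lemma walk_count_2_one_return:
  assumes IH: "\<And>x y. x \<in> verts G1 \<Longrightarrow> y \<in> verts G2 \<Longrightarrow>
      walk_count 1 1 (2 * n) (\<iota> (x, y)) = fps_nth (one_return_1 x y) n"
    and xy: "x \<in> verts G1" "y \<in> verts G2"
  shows "walk_count 2 1 (Suc (2 * n)) (\<iota> (x, y)) = fps_nth (one_return_2 x y) n"
proof -
  define U where "U x y = (if x = x0 \<and> y = s then 1 else one_return_1 x y)" for x y
  have "walk_count 2 1 (Suc (2 * n)) (\<iota> (x, y)) = fps_nth (adj_fps G2 (U x) y) n"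
    unfolding One_nat_def using IH xy by (intro walk_count_2_Suc) (auto simp: U_def walk_count_no_return)
  also have "adj_fps G2 (U x) y = one_return_2 x y"
  proof (cases "x = x0")
    case True
    then show ?thesis
      unfolding one_return_2_def by (subst hit_series_eq) (auto simp: U_def one_return_1_def intro!: adj_fps_cong)
  next
    case False
    then have "U x = (\<lambda>y. 0)" by (auto simp: U_def one_return_1_def)
    then show ?thesis using False by (simp add: one_return_2_def adj_fps_zero)
  qed
  finally show ?thesis .
qed

lemma walk_count_1_one_return:
  assumes "x \<in> verts G1" "y \<in> verts G2"
  shows "walk_count 1 1 (2 * n) (\<iota> (x, y)) = fps_nth (one_return_1 x y) n"
  using assms
proof (induction n arbitrary: x y)
  case 0
  then show ?case using walk_count_0[of 1 0] by (simp add: one_return_1_def)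
next
  case (Suc n)
  define U where "U x y = (if x = x0 \<and> y = s then 0 else one_return_2 x y)" for x y
  have "walk_count 1 1 (Suc (Suc (2 * n))) (\<iota> (x, y)) =
      fps_nth (if y = r x then adj_fps G1 (\<lambda>x'. U x' (r x')) x else U x y) n"
    using walk_count_1_Suc[where j = 0 and m = "Suc (2 * n)" and U = U and n = n, OF _ Suc.prems]
      walk_count_2_one_return[OF Suc.IH]
    by (simp add: U_def walk_count_no_return)
  also have "(\<lambda>x'. U x' (r x')) = (\<lambda>x'. 0)"
    by (auto simp: U_def one_return_2_def r_x0)
  finally show ?case by (auto simp: one_return_1_def U_def one_return_2_def adj_fps_zero r)
qed

lemma walk_count_2_two_returns:
  assumes IH: "\<And>x y. x \<in> verts G1 \<Longrightarrow> y \<in> verts G2 \<Longrightarrow>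
      walk_count 1 2 (2 * n) (\<iota> (x, y)) = fps_nth (two_returns_1 x y) n"
    and xy: "x \<in> verts G1" "y \<in> verts G2"
  shows "walk_count 2 2 (Suc (2 * n)) (\<iota> (x, y)) = fps_nth (two_returns_2 x y) n"
proof -
  define U where "U x y = (if x = x0 \<and> y = s then one_return_1 x y else two_returns_1 x y)" for x y
  have two: "Suc 1 = 2" by simp
  have "walk_count 2 (Suc 1) (Suc (2 * n)) (\<iota> (x, y)) = fps_nth (adj_fps G2 (U x) y) n"
    by (rule walk_count_2_Suc[OF _ xy], unfold two)
      (simp add: U_def IH[unfolded One_nat_def]
        walk_count_1_one_return[unfolded One_nat_def] roots)
  also have "adj_fps G2 (U x) y = two_returns_2 x y"
  proof (cases "x = x0")
    case True
    then have "U x = (\<lambda>y. 0)" by (auto simp: U_def one_return_1_def two_returns_1_def r_x0)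
    then show ?thesis using True by (simp add: two_returns_2_def adj_fps_zero)
  next
    case False
    then show ?thesis
      unfolding two_returns_2_def using hit_series_eq_mult[OF G2 xy(2), of t "excursion_s * spine x", symmetric]
      by (auto simp: U_def two_returns_1_def r_other intro!: adj_fps_cong)
  qed
  finally show ?thesis by (simp only: two)
qed

lemma walk_count_1_two_returns:
  assumes "x \<in> verts G1" "y \<in> verts G2"
  shows "walk_count 1 2 (2 * n) (\<iota> (x, y)) = fps_nth (two_returns_1 x y) n"
  using assms
proof (induction n arbitrary: x y)
  case 0
  then show ?case using walk_count_0[of 1 1] 
    by (simp add: two_returns_1_def excursion_s_0 numeral_2_eq_2 mult.assoc)
next
  case (Suc n)
  define U where "U x y = (if x = x0 \<and> y = s then one_return_2 x y else two_returns_2 x y)" for x y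
  have two: "Suc 1 = 2" by simp
  have "walk_count 1 (Suc 1) (Suc (Suc (2 * n))) (\<iota> (x, y)) =
      fps_nth (if y = r x then adj_fps G1 (\<lambda>x'. U x' (r x')) x else U x y) n"
    by (rule walk_count_1_Suc[OF _ Suc.prems], unfold two)
      (simp add: U_def walk_count_2_one_return[OF walk_count_1_one_return, unfolded One_nat_def]
        walk_count_2_two_returns[OF Suc.IH] roots)
  also have "\<dots> = fps_nth (two_returns_1 x y) (Suc n)"
  proof (cases "y = r x")
    case True
    have "U x' (r x') = (if x' = x0 then hit_series G2 s s
        else excursion_t * spine x' * hit_series G2 s s)" for x'
      by (cases "x' = x0") (simp_all add: U_def one_return_2_def two_returns_2_def r_x0 r_other
        excursion_t_def excursion_s_def mult_ac)
    then have "adj_fps G1 (\<lambda>x'. U x' (r x')) x = spine x * hit_series G2 s s"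
      using spine_eq[OF Suc.prems(1)] by simp
    then have "two_returns_1 x y = fps_X * adj_fps G1 (\<lambda>x'. U x' (r x')) x"
      using True by (simp add: two_returns_1_def excursion_s_def mult_ac)
    with True show ?thesis by simp
  next
    case False
    then show ?thesis by (auto simp: U_def two_returns_1_def two_returns_2_def r_x0 mult.assoc)
  qed
  finally show ?case by (simp only: two mult_Suc_right add_2_eq_Suc)
qed

lemma card_alt_d_walks:
  "of_nat (card (alt_d_walks G (2 * n) (\<iota> (x0, s)))) = fps_nth (excursion_s * spine x0) n"
  using walk_count_1_two_returns[OF roots(1,2), of n] by (simp add: alt_d_walks_eq walk_count_def two_returns_1_def r_x0)

lemma excursion_s_eq: "excursion_s = eta (spectral_distr G2 s)"
  and excursion_t_eq: "excursion_t = eta (spectral_distr G2 t)"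
  by (simp_all add: excursion_t_def excursion_s_def eta_spectral_distr G2 roots)

text \<open>The value found for the root, cleared of its denominator: passing from \<open>hit_series\<close> to \<open>\<eta>\<close> costs one
factor of the variable, which the substitution turns into \<open>excursion_t\<close>.\<close>

lemma excursion_t_times_spine:
  "excursion_t * (excursion_s * spine x0) = excursion_s * (eta (spectral_distr G1 x0) oo excursion_t)"
  by (simp add: eta_spectral_distr G1 roots spine_def fps_compose_mult_distrib excursion_t_0 mult_ac)

end

section \<open>The two convolutions\<close>

lemma c_comb_loop_eq:
  "c_comb_loop (G1, e1, f1) (G2, e2, f2) =
    (disjoint_union (looped_attach G1 (\<lambda>x. if x = e1 then e2 else f2) G2) (looped_attach G1 (\<lambda>_. f2) G2),
     Inl (e1, e2), Inr (f1, f2))"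
  by (simp add: c_comb_loop_def comb_loop_at_def comb_loop_def comb_at_def comb_def looped_attach_def)

lemma N_distr_of_eta:
  assumes "fps_nth g 0 = 0"
  shows "N_distr (distr_of_eta g) n = fps_nth g n"
proof -
  have "eta (distr_of_eta g) = g"
    unfolding distr_of_eta_def using theI'[OF ex1_distribution_eta[OF assms]] by blast
  then show ?thesis by (simp add: N_distr_def)
qed

theorem theorem5p1:
  fixes G1 :: "('v1, 'e1) mgraph" and e1 f1 :: 'v1
    and G2 :: "('v2, 'e2) mgraph" and e2 f2 :: 'v2
    and G :: "('v1, 'e1, 'v2, 'e2) c_comb_loop_graph"
    and e f :: "'v1 \<times> 'v2 + 'v1 \<times> 'v2"
    and \<mu>1 \<mu>2 \<nu>1 \<nu>2 :: "complex poly \<Rightarrow> complex"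
    and R1 R2 Z :: "('v1 \<times> 'v2 + 'v1 \<times> 'v2 \<Rightarrow> complex) \<Rightarrow> 'v1 \<times> 'v2 + 'v1 \<times> 'v2 \<Rightarrow> complex"
    and n :: nat
  assumes "birooted_graph (G1, e1, f1)" and "birooted_graph (G2, e2, f2)"
    and "\<mu>1 = spectral_distr G1 e1" and "\<mu>2 = spectral_distr G2 e2"
    and "\<nu>1 = spectral_distr G1 f1" and "\<nu>2 = spectral_distr G2 f2"
    and "\<not> concentrated_at_zero \<nu>2"
    and "(G, e, f) = c_comb_loop (G1, e1, f1) (G2, e2, f2)"
    and "R1 = color_op G 1" and "R2 = color_op G 2" and "Z = R2 \<circ> R1"
  shows "N_op (verts G) Z e n = N_distr (c_conv \<mu>1 \<nu>2 \<mu>2) n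
       \<and> N_distr (c_conv \<mu>1 \<nu>2 \<mu>2) n = of_nat (card (alt_d_walks G (2 * n) e))
       \<and> N_op (verts G) Z f n = N_distr (mono_conv \<nu>1 \<nu>2) n
       \<and> N_distr (mono_conv \<nu>1 \<nu>2) n = of_nat (card (alt_d_walks G (2 * n) f))"
proof -
  have G1: "wf_mgraph G1" "uniformly_locally_finite G1" "e1 \<in> verts G1" "f1 \<in> verts G1"
    and G2: "wf_mgraph G2" "uniformly_locally_finite G2" "e2 \<in> verts G2" "f2 \<in> verts G2"
    using assms(1,2) by (auto simp: birooted_graph_def)
  note G = c_comb_loop_decomposition(1,2)[OF assms(1,2,8)]
  define r where "r x = (if x = e1 then e2 else f2)" for x
  define H1 where "H1 = looped_attach G1 r G2"
  define H2 where "H2 = looped_attach G1 (\<lambda>_. f2) G2"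
  have G_eq: "G = disjoint_union H1 H2" and e: "e = Inl (e1, e2)" and f: "f = Inr (f1, f2)"
    using assms(8) by (simp_all add: c_comb_loop_eq H1_def H2_def r_def[abs_def])
  have col: "\<forall>a\<in>edges G. color G a \<in> {1, 2}"
    by (auto simp: G_eq H1_def H2_def looped_attach_def disjoint_union_def add_loops_def attach_def)
  have V: "verts H1 = verts G1 \<times> verts G2" "verts H2 = verts G1 \<times> verts G2"
    by (simp_all add: H1_def H2_def looped_attach_def add_loops_def attach_def)
  have H: "wf_mgraph H1" "wf_mgraph H2"
    unfolding H1_def H2_def using G1 G2 by (auto intro!: wf_looped_attach simp: r_def)
  interpret e: loop_product_component G1 G2 G Inl e1 e2 f2 r
    by unfold_locales
      (use G1 G2 G col in \<open>auto simp: G_eq color_op_disjoint_union[OF H] V r_def simp flip: H1_def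
        intro!: verts_disjoint_unionI\<close>)
  interpret f: loop_product_component G1 G2 G Inr f1 f2 f2 "\<lambda>_. f2"
    by unfold_locales
      (use G1 G2 G col in \<open>auto simp: G_eq color_op_disjoint_union[OF H] V simp flip: H2_def
        intro!: verts_disjoint_unionI\<close>)
  \<comment> \<open>The hypothesis on \<open>\<nu>2\<close> makes it possible to cancel \<open>excursion_t\<close>, which is its \<open>\<eta>\<close>-series.\<close>
  have nz: "eta \<nu>2 \<noteq> 0"
    using assms(6,7) eta_eq_0_iff distribution_spectral_distr(1)[OF G2(4)] by blast
  have "c_conv_series \<mu>1 \<nu>2 \<mu>2 * eta \<nu>2 = e.excursion_s * e.spine e1 * eta \<nu>2"
    using c_conv_series_exact(1)[OF nz, of \<mu>1 \<mu>2] e.excursion_t_times_spine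
    by (simp only: assms(3,4,6) e.excursion_t_eq e.excursion_s_eq mult.commute)
  then have "c_conv_series \<mu>1 \<nu>2 \<mu>2 = e.excursion_s * e.spine e1"
    using nz by simp
  moreover have "eta \<nu>1 oo eta \<nu>2 = f.excursion_s * f.spine f1"
    using f.excursion_t_times_spine nz by (simp add: assms(5,6) f.excursion_t_eq f.excursion_s_eq)
  ultimately have N: "N_distr (c_conv \<mu>1 \<nu>2 \<mu>2) n = fps_nth (e.excursion_s * e.spine e1) n"
    "N_distr (mono_conv \<nu>1 \<nu>2) n = fps_nth (f.excursion_s * f.spine f1) n"
    by (simp_all add: c_conv_def mono_conv_def N_distr_of_eta e.excursion_s_0 f.excursion_s_0)
  show ?thesis
    unfolding N N_op_def assms(9-11) e f e.eta_Z f.eta_Z e.card_alt_d_walks f.card_alt_d_walks by simp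
qed

end
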